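(* The Leibniz class of truth-equational logics is meet-prime among logics with theorems. That is: for every pair $\mathbb K_1,\mathbb K_2$ of Leibniz classes all of whose members are logics with theorems, if every logic in $\mathbb K_1\cap\mathbb K_2$ is truth-equational, then either every logic in $\mathbb K_1$ is truth-equational or every logic in $\mathbb K_2$ is truth-equational.
   Context: Languages and logics. An algebraic language is a set of function symbols of positive finite arity (constants are treated as unary symbols). For a language $\mathcal{L}$ and an infinite cardinal $\kappa$, $Fm_{\mathcal{L}}(\kappa)$ is the set (and absolutely free algebra) of $\mathcal{L}$-terms, called formulas, over variables $\{x_\alpha : \alpha<\kappa\}$. A logic $\vdash$ is a consequence relation on $Fm_{\mathcal L}(\kappa)$, for some $\mathcal L$ and some infinite $\kappa$ (a relation between sets of formulas and formulas such that $\Gamma\vdash\gamma$ for $\gamma\in\Gamma$, and if $\Gamma\vdash\delta$ for all $\delta\in\Delta$ and $\Delta\vdash\varphi$ then $\Gamma\vdash\varphi$) that is substitution invariant ($\Gamma\vdash\varphi$ implies $\sigma[\Gamma]\vdash\sigma(\varphi)$ for every endomorphism $\sigma$ of the formula algebra). Finitarity is not assumed. Its language is $\mathcal L_\vdash$. A logic has theorems if $\emptyset\vdash\varphi$ for some formula $\varphi$. Matrices. A matrix is a pair $\langle \boldsymbol A,F\rangle$ with $\boldsymbol A$ an algebra and $F\subseteq A$. A model of $\vdash$ is a matrix $\langle \boldsymbol A,F\rangle$ with $\boldsymbol A$ an $\mathcal L_\vdash$-algebra such that, whenever $\Gamma\vdash\varphi$ and $h$ is a homomorphism from the formula algebra of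 $\vdash$ to $\boldsymbol A$ with $h[\Gamma]\subseteq F$, then $h(\varphi)\in F$; in this case $F$ is called a deductive filter of $\vdash$ on $\boldsymbol A$. A congruence $\theta$ is compatible with $F$ if $a\in F$ and $\langle a,b\rangle\in\theta$ imply $b\in F$; the Leibniz congruence $\boldsymbol\Omega^{\boldsymbol A}F$ is the largest congruence of $\boldsymbol A$ compatible with $F$. The Suszko congruence $\widetilde{\boldsymbol\Omega}{}^{\boldsymbol A}_{\vdash}F$ is the intersection of all $\boldsymbol\Omega^{\boldsymbol A}G$, where $G\supseteq F$ is a deductive filter of $\vdash$ on $\boldsymbol A$. $\mathsf{Mod}^{\equiv}(\vdash)$ is the class of models $\langle\boldsymbol A,F\rangle$ of $\vdash$ such that $\widetilde{\boldsymbol\Omega}{}^{\boldsymbol A}_{\vdash}F$ is the identity relation. Interpretability. A translation $\boldsymbol\tau$ of $\mathcal L$ into $\mathcal L'$ maps each $n$-ary symbol $\ast\in\mathcal L$ to an $\mathcal L'$-term $\boldsymbol\tau(\ast)(x_1,\dots,x_n)$. For an $\mathcal L'$-algebra $\boldsymbol A$, $\boldsymbol A^{\boldsymbol\tau}$ is the $\mathcal L$-algebra on $A$ in which $\ast$ is interpreted as the term-function $\boldsymbol\tau(\ast)^{\boldsymbol A}$. An interpretation of $\vdash$ into $\vdash'$ is a translation $\boldsymbol\tau$ of $\mathcal L_\vdash$ into $\mathcal L_{\vdash'}$ such that $\langle\boldsymbol A^{\boldsymbol\tau},F\rangle\in\mathsf{Mod}^{\equiv}(\vdash)$ for all $\langle\boldsymbol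 A,F\rangle\in\mathsf{Mod}^{\equiv}(\vdash')$. Write ${\vdash}\leq{\vdash'}$ if there is one. Leibniz classes. A Leibniz condition is a class $\Phi=\{\vdash_{\Phi_\alpha} : \alpha \text{ an ordinal}\}$ of logics such that $\alpha\leq\beta$ implies ${\vdash_{\Phi_\beta}}\leq{\vdash_{\Phi_\alpha}}$; $\mathrm{Log}(\Phi)$ is the class of logics $\vdash$ with ${\vdash_{\Phi_\alpha}}\leq{\vdash}$ for some ordinal $\alpha$. A Leibniz class is a class of logics of the form $\mathrm{Log}(\Phi)$ for some Leibniz condition $\Phi$. Truth-equational logics form a Leibniz class. A logic $\vdash$ is truth-equational if there is a set $E(x)$ of equations (between $\mathcal L_\vdash$-terms in the single variable $x$) such that for every $\langle\boldsymbol A,F\rangle\in\mathsf{Mod}^{\equiv}(\vdash)$ and $a\in A$: $a\in F$ iff $\boldsymbol A\vDash E(a)$. *)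

theory Defs
  imports Main
begin

unbundle cardinal_syntax

section \<open>The universe of sets\<close>

text \<open>
  Leibniz classes are collections of logics indexed by \<^emph>\<open>all\<close> ordinals, and the models of a logic
  form a proper class. We work relative to a universe of sets, given by a well-ordered type
  \<open>'u\<close> of strongly inaccessible cardinality whose order type is its cardinality:
  elements of \<open>'u\<close> are the ordinals, subsets of \<open>'u\<close> of size less than \<open>'u\<close> are the sets, and
  arbitrary collections are the classes. Up to a bijection of \<open>'u\<close> with the
  level \<open>V\<^sub>\<kappa>\<close> of the cumulative hierarchy, where \<open>\<kappa>\<close> is the cardinality of \<open>'u\<close>, the small
  subsets of \<open>'u\<close> are exactly the elements of \<open>V\<^sub>\<kappa>\<close>.
\<close>

definition small :: "'u set \<Rightarrow> bool" where
  "small A \<longleftrightarrow> |A| <o |UNIV :: 'u set|"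

definition inaccessible_universe :: "'u::wellorder itself \<Rightarrow> bool" where
  "inaccessible_universe _ \<longleftrightarrow>
     natLeq <o |UNIV :: 'u set| \<and>
     regularCard |UNIV :: 'u set| \<and>
     (\<forall>A :: 'u set. small A \<longrightarrow> |Pow A| <o |UNIV :: 'u set| ) \<and>
     (\<forall>\<alpha> :: 'u. small {..<\<alpha>})"

text \<open>Initial ordinals: an ordinal \<open>\<kappa>\<close> is identified with the set \<open>{..<\<kappa>}\<close> of its predecessors.\<close>

definition infinite_cardinal :: "'u::wellorder \<Rightarrow> bool" where
  "infinite_cardinal \<kappa> \<longleftrightarrow> infinite {..<\<kappa>} \<and> (\<forall>\<alpha><\<kappa>. |{..<\<alpha>}| <o |{..<\<kappa>}| )"


section \<open>Languages, algebras, terms\<close>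

record 'f language =
  syms :: "'f set"
  arity :: "'f \<Rightarrow> nat"

definition is_language :: "'u language \<Rightarrow> bool" where
  "is_language L \<longleftrightarrow> small (syms L) \<and> (\<forall>f\<in>syms L. 0 < arity L f)"

text \<open>
  The value of \<open>interp A f as\<close> is meaningful only if \<open>f\<close> is a symbol of the language and \<open>as\<close> is a
  list of elements of the carrier of length \<open>arity L f\<close>.
\<close>

record ('f, 'a) algebra =
  carrier :: "'a set"
  interp :: "'f \<Rightarrow> 'a list \<Rightarrow> 'a"

definition is_algebra :: "'f language \<Rightarrow> ('f, 'a) algebra \<Rightarrow> bool" where
  "is_algebra L A \<longleftrightarrow> carrier A \<noteq> {} \<and>
     (\<forall>f\<in>syms L. \<forall>as. length as = arity L f \<and> set as \<subseteq> carrier A \<longrightarrow> interp A f as \<in> carrier A)"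

definition is_hom ::
  "'f language \<Rightarrow> ('f, 'a) algebra \<Rightarrow> ('f, 'b) algebra \<Rightarrow> ('a \<Rightarrow> 'b) \<Rightarrow> bool" where
  "is_hom L A B h \<longleftrightarrow> h ` carrier A \<subseteq> carrier B \<and>
     (\<forall>f\<in>syms L. \<forall>as. length as = arity L f \<and> set as \<subseteq> carrier A \<longrightarrow>
        h (interp A f as) = interp B f (map h as))"

datatype ('f, 'v) tm = Var 'v | Fun 'f "('f, 'v) tm list"

inductive_set terms :: "'f language \<Rightarrow> 'v set \<Rightarrow> ('f, 'v) tm set"
  for L :: "'f language" and X :: "'v set" where
  Var: "x \<in> X \<Longrightarrow> Var x \<in> terms L X"
| Fun: "f \<in> syms L \<Longrightarrow> length ts = arity L f \<Longrightarrow> (\<And>t. t \<in> set ts \<Longrightarrow> t \<in> terms L X) \<Longrightarrow>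
        Fun f ts \<in> terms L X"

primrec eval :: "('f, 'a) algebra \<Rightarrow> ('v \<Rightarrow> 'a) \<Rightarrow> ('f, 'v) tm \<Rightarrow> 'a" where
  "eval A v (Var x) = v x"
| "eval A v (Fun f ts) = interp A f (map (eval A v) ts)"

text \<open>The algebra of formulas over the variables \<open>x\<^sub>\<alpha>\<close>, written \<open>Var \<alpha>\<close>, for \<open>\<alpha> < \<kappa>\<close>.\<close>

definition Fm :: "'f language \<Rightarrow> 'u::wellorder \<Rightarrow> ('f, ('f, 'u) tm) algebra" where
  "Fm L \<kappa> = \<lparr> carrier = terms L {..<\<kappa>}, interp = Fun \<rparr>"


section \<open>Logics\<close>

record 'u logic =
  lang :: "'u language"
  nvars :: 'u
  entails :: "('u, 'u) tm set \<Rightarrow> ('u, 'u) tm \<Rightarrow> bool"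

abbreviation formula_algebra :: "'u::wellorder logic \<Rightarrow> ('u, ('u, 'u) tm) algebra" where
  "formula_algebra l \<equiv> Fm (lang l) (nvars l)"

abbreviation formulas :: "'u::wellorder logic \<Rightarrow> ('u, 'u) tm set" where
  "formulas l \<equiv> carrier (formula_algebra l)"

definition consequence_relation :: "'a set \<Rightarrow> ('a set \<Rightarrow> 'a \<Rightarrow> bool) \<Rightarrow> bool" where
  "consequence_relation M C \<longleftrightarrow>
     (\<forall>\<Gamma> \<phi>. C \<Gamma> \<phi> \<longrightarrow> \<Gamma> \<subseteq> M \<and> \<phi> \<in> M) \<and>
     (\<forall>\<Gamma> \<gamma>. \<Gamma> \<subseteq> M \<and> \<gamma> \<in> \<Gamma> \<longrightarrow> C \<Gamma> \<gamma>) \<and>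
     (\<forall>\<Gamma> \<Delta> \<phi>. \<Gamma> \<subseteq> M \<and> (\<forall>\<delta>\<in>\<Delta>. C \<Gamma> \<delta>) \<and> C \<Delta> \<phi> \<longrightarrow> C \<Gamma> \<phi>)"

definition is_logic :: "'u::wellorder logic \<Rightarrow> bool" where
  "is_logic l \<longleftrightarrow>
     is_language (lang l) \<and>
     infinite_cardinal (nvars l) \<and>
     consequence_relation (formulas l) (entails l) \<and>
     (\<forall>\<sigma> \<Gamma> \<phi>. is_hom (lang l) (formula_algebra l) (formula_algebra l) \<sigma> \<and> entails l \<Gamma> \<phi> \<longrightarrow>
        entails l (\<sigma> ` \<Gamma>) (\<sigma> \<phi>))"

definition has_theorems :: "'u logic \<Rightarrow> bool" where
  "has_theorems l \<longleftrightarrow> (\<exists>\<phi>. entails l {} \<phi>)"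


section \<open>Matrices\<close>

definition deductive_filter :: "'u::wellorder logic \<Rightarrow> ('u, 'a) algebra \<Rightarrow> 'a set \<Rightarrow> bool" where
  "deductive_filter l A F \<longleftrightarrow> F \<subseteq> carrier A \<and>
     (\<forall>\<Gamma> \<phi> h. entails l \<Gamma> \<phi> \<and> is_hom (lang l) (formula_algebra l) A h \<and> h ` \<Gamma> \<subseteq> F \<longrightarrow> h \<phi> \<in> F)"

definition congruence :: "'f language \<Rightarrow> ('f, 'a) algebra \<Rightarrow> ('a \<times> 'a) set \<Rightarrow> bool" where
  "congruence L A \<theta> \<longleftrightarrow> equiv (carrier A) \<theta> \<and>
     (\<forall>f\<in>syms L. \<forall>as bs. length as = arity L f \<and> list_all2 (\<lambda>a b. (a, b) \<in> \<theta>) as bs \<longrightarrow>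
        (interp A f as, interp A f bs) \<in> \<theta>)"

definition compatible :: "('a \<times> 'a) set \<Rightarrow> 'a set \<Rightarrow> bool" where
  "compatible \<theta> F \<longleftrightarrow> (\<forall>a b. a \<in> F \<and> (a, b) \<in> \<theta> \<longrightarrow> b \<in> F)"

definition Leibniz_congruence ::
  "'f language \<Rightarrow> ('f, 'a) algebra \<Rightarrow> 'a set \<Rightarrow> ('a \<times> 'a) set" where
  "Leibniz_congruence L A F = (GREATEST \<theta>. congruence L A \<theta> \<and> compatible \<theta> F)"

definition Suszko_congruence ::
  "'u::wellorder logic \<Rightarrow> ('u, 'a) algebra \<Rightarrow> 'a set \<Rightarrow> ('a \<times> 'a) set" where
  "Suszko_congruence l A F =
     \<Inter> {Leibniz_congruence (lang l) A G | G. deductive_filter l A G \<and> F \<subseteq> G}"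

text \<open>The class \<open>Mod\<^sup>\<equiv>(l)\<close>.\<close>

definition Mod_Suszko :: "'u::wellorder logic \<Rightarrow> (('u, 'u) algebra \<times> 'u set) set" where
  "Mod_Suszko l = {(A, F). is_algebra (lang l) A \<and> small (carrier A) \<and> deductive_filter l A F \<and>
     Suszko_congruence l A F = Id_on (carrier A)}"

text \<open>The following lemmas justify the use of \<open>GREATEST\<close> above: the greatest element exists.\<close>

lemma congruence_join:
  assumes A: "is_algebra L A" and ne: "C \<noteq> {}"
    and C: "\<And>\<theta>. \<theta> \<in> C \<Longrightarrow> congruence L A \<theta> \<and> compatible \<theta> F"
  shows "congruence L A ((\<Union>C)\<^sup>+) \<and> compatible ((\<Union>C)\<^sup>+) F"
proof -
  let ?R = "\<Union>C"
  have eq: "equiv (carrier A) \<theta>" if "\<theta> \<in> C" for \<theta>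
    using C[OF that] by (simp add: congruence_def)
  have sub: "?R \<subseteq> carrier A \<times> carrier A"
    using eq by (fastforce simp: equiv_def)
  have sub': "?R\<^sup>+ \<subseteq> carrier A \<times> carrier A"
    by (rule trancl_subset_Sigma[OF sub])
  have refl: "refl_on (carrier A) (?R\<^sup>+)"
    using eq ne by (fastforce simp: refl_on_def equiv_def)
  have "sym ?R"
    using eq by (fastforce simp: equiv_def intro!: sym_UNION[of C id, simplified])
  hence "equiv (carrier A) (?R\<^sup>+)"
    using sub' refl by (auto intro!: equivI sym_trancl)
  moreover have "(interp A f as, interp A f bs) \<in> ?R\<^sup>+"
    if f: "f \<in> syms L" and len: "length as = arity L f"
      and l: "list_all2 (\<lambda>a b. (a, b) \<in> ?R\<^sup>+) as bs" for f as bs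
  proof -
    have one: "(interp A f (xs @ a # ys), interp A f (xs @ b # ys)) \<in> ?R\<^sup>+"
      if xs: "set xs \<subseteq> carrier A" and ys: "set ys \<subseteq> carrier A"
        and n: "length xs + Suc (length ys) = arity L f" and ab: "(a, b) \<in> ?R\<^sup>+" for xs ys a b
    proof -
      have step: "(interp A f (xs @ c # ys), interp A f (xs @ d # ys)) \<in> ?R" if "(c, d) \<in> ?R" for c d
      proof -
        obtain \<theta> where \<theta>: "\<theta> \<in> C" "(c, d) \<in> \<theta>"
          using \<open>(c, d) \<in> ?R\<close> by blast
        have r: "(z, z) \<in> \<theta>" if "z \<in> carrier A" for z
          using eq[OF \<theta>(1)] that by (auto simp: equiv_def refl_on_def)
        have "list_all2 (\<lambda>a b. (a, b) \<in> \<theta>) (xs @ c # ys) (xs @ d # ys)"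
          using subsetD[OF xs, THEN r] subsetD[OF ys, THEN r] \<theta>(2)
          by (auto intro!: list_all2_appendI simp: list_all2_same)
        hence "(interp A f (xs @ c # ys), interp A f (xs @ d # ys)) \<in> \<theta>"
          using C[OF \<theta>(1)] f n unfolding congruence_def by auto
        thus ?thesis
          using \<theta>(1) by blast
      qed
      show ?thesis
        using ab by (induction rule: trancl_induct) (blast intro: step trancl_into_trancl)+
    qed
    have refl': "(interp A f xs, interp A f xs) \<in> ?R\<^sup>+"
      if "set xs \<subseteq> carrier A" "length xs = arity L f" for xs
      using A f that refl by (auto simp: is_algebra_def refl_on_def)
    have "(interp A f (xs @ as), interp A f (xs @ bs)) \<in> ?R\<^sup>+"
      if "set xs \<subseteq> carrier A" "length xs + length as = arity L f" for xs
      using l that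
    proof (induction arbitrary: xs rule: list_all2_induct)
      case Nil thus ?case
        using refl' by simp
    next
      case (Cons a as b bs)
      have ab: "b \<in> carrier A" "set as \<subseteq> carrier A"
        using Cons.hyps sub' by (auto simp: list_all2_conv_all_nth set_conv_nth)
      have "(interp A f (xs @ a # as), interp A f (xs @ b # as)) \<in> ?R\<^sup>+"
        using one[of xs as a b] Cons.prems Cons.hyps ab by auto
      moreover have "(interp A f ((xs @ [b]) @ as), interp A f ((xs @ [b]) @ bs)) \<in> ?R\<^sup>+"
        using Cons.prems ab by (intro Cons.IH) auto
      ultimately show ?case
        by simp
    qed
    from this[of "[]"] len show ?thesis
      by simp
  qed
  moreover have "compatible (?R\<^sup>+) F"
  proof -
    have "b \<in> F" if "(a, b) \<in> ?R\<^sup>+" "a \<in> F" for a b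
      using that by (induction rule: trancl_induct) (use C in \<open>auto simp: compatible_def\<close>)
    thus ?thesis
      by (auto simp: compatible_def)
  qed
  ultimately show ?thesis
    by (auto simp: congruence_def)
qed

lemma Leibniz_congruence_greatest:
  assumes A: "is_algebra L A" and F: "F \<subseteq> carrier A"
  shows "congruence L A (Leibniz_congruence L A F)"
    and "compatible (Leibniz_congruence L A F) F"
    and "congruence L A \<theta> \<Longrightarrow> compatible \<theta> F \<Longrightarrow> \<theta> \<subseteq> Leibniz_congruence L A F"
proof -
  let ?P = "\<lambda>\<theta>. congruence L A \<theta> \<and> compatible \<theta> F"
  have Id: "?P (Id_on (carrier A))"
  proof -
    have "as = bs" if "list_all2 (\<lambda>a b. (a, b) \<in> Id_on (carrier A)) as bs" for as bs
      using that by (induction rule: list_all2_induct) auto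
    moreover have "set as \<subseteq> carrier A"
      if "list_all2 (\<lambda>a b. (a, b) \<in> Id_on (carrier A)) as bs" for as bs
      using that by (induction rule: list_all2_induct) auto
    ultimately have "(interp A f as, interp A f bs) \<in> Id_on (carrier A)"
      if "f \<in> syms L" "length as = arity L f"
        "list_all2 (\<lambda>a b. (a, b) \<in> Id_on (carrier A)) as bs" for f as bs
      using that A by (metis Id_onI is_algebra_def)
    thus ?thesis
      by (auto simp: congruence_def compatible_def equiv_def refl_on_def sym_def trans_def)
  qed
  define T where "T = (\<Union>{\<theta>. ?P \<theta>})\<^sup>+"
  have T: "?P T"
    unfolding T_def using Id by (intro congruence_join[OF A]) auto
  have max: "\<theta> \<subseteq> T" if "?P \<theta>" for \<theta>
    using that unfolding T_def by auto
  have "Leibniz_congruence L A F = T"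
    unfolding Leibniz_congruence_def using T max by (intro Greatest_equality) auto
  thus "congruence L A (Leibniz_congruence L A F)"
    and "compatible (Leibniz_congruence L A F) F"
    and "congruence L A \<theta> \<Longrightarrow> compatible \<theta> F \<Longrightarrow> \<theta> \<subseteq> Leibniz_congruence L A F"
    using T max by auto
qed


section \<open>Interpretability\<close>

text \<open>The term \<open>\<tau> f\<close> is written in the variables \<open>0, \<dots>, arity L f - 1\<close>, standing for the arguments.\<close>

definition translation ::
  "'f language \<Rightarrow> 'g language \<Rightarrow> ('f \<Rightarrow> ('g, nat) tm) \<Rightarrow> bool" where
  "translation L L' \<tau> \<longleftrightarrow> (\<forall>f\<in>syms L. \<tau> f \<in> terms L' {..<arity L f})"

definition translate_algebra ::
  "('f \<Rightarrow> ('g, nat) tm) \<Rightarrow> ('g, 'a) algebra \<Rightarrow> ('f, 'a) algebra" where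
  "translate_algebra \<tau> A = \<lparr> carrier = carrier A, interp = (\<lambda>f as. eval A (\<lambda>i. as ! i) (\<tau> f)) \<rparr>"

definition interpretation_into ::
  "('u \<Rightarrow> ('u, nat) tm) \<Rightarrow> 'u::wellorder logic \<Rightarrow> 'u logic \<Rightarrow> bool" where
  "interpretation_into \<tau> l l' \<longleftrightarrow> translation (lang l) (lang l') \<tau> \<and>
     (\<forall>(A, F) \<in> Mod_Suszko l'. (translate_algebra \<tau> A, F) \<in> Mod_Suszko l)"

definition interpretable :: "'u::wellorder logic \<Rightarrow> 'u logic \<Rightarrow> bool" (infix "\<preceq>" 50) where
  "l \<preceq> l' \<longleftrightarrow> (\<exists>\<tau>. interpretation_into \<tau> l l')"


section \<open>Leibniz classes\<close>

definition leibniz_condition :: "('u::wellorder \<Rightarrow> 'u logic) \<Rightarrow> bool" where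
  "leibniz_condition \<Phi> \<longleftrightarrow> (\<forall>\<alpha>. is_logic (\<Phi> \<alpha>)) \<and> (\<forall>\<alpha> \<beta>. \<alpha> \<le> \<beta> \<longrightarrow> \<Phi> \<beta> \<preceq> \<Phi> \<alpha>)"

definition Log :: "('u::wellorder \<Rightarrow> 'u logic) \<Rightarrow> 'u logic set" where
  "Log \<Phi> = {l. is_logic l \<and> (\<exists>\<alpha>. \<Phi> \<alpha> \<preceq> l)}"

definition leibniz_class :: "'u::wellorder logic set \<Rightarrow> bool" where
  "leibniz_class K \<longleftrightarrow> (\<exists>\<Phi>. leibniz_condition \<Phi> \<and> K = Log \<Phi>)"

text \<open>Equations in the single variable \<open>x\<close> are pairs of terms over the one-element set of variables
  \<open>UNIV :: unit set\<close>.\<close>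

definition truth_equational :: "'u::wellorder logic \<Rightarrow> bool" where
  "truth_equational l \<longleftrightarrow>
     (\<exists>E :: (('u, unit) tm \<times> ('u, unit) tm) set.
        E \<subseteq> terms (lang l) UNIV \<times> terms (lang l) UNIV \<and>
        (\<forall>(A, F) \<in> Mod_Suszko l. \<forall>a \<in> carrier A.
           a \<in> F \<longleftrightarrow> (\<forall>(s, t) \<in> E. eval A (\<lambda>_. a) s = eval A (\<lambda>_. a) t)))"

end

theory Submission
  imports Defs "HOL-Library.FuncSet"
begin

text \<open>
  Leibniz classes are closed upwards under interpretability, so it suffices that any two logics
  \<open>l\<^sub>1\<close>, \<open>l\<^sub>2\<close> with theorems that are not truth-equational have a common upper bound that is not
  truth-equational either (\<open>not_truth_equational_upper_bound\<close>).

  Failure of truth-equationality can be witnessed on a single algebra: there are an algebra and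
  filters \<open>G\<^sub>0 \<subset> G\<^sub>1\<close> on it such that both matrices are Suszko-reduced (\<open>two_reduced_filters\<close>). To
  see this, divide the formula algebra by the Suszko congruence of the theory of a variable \<open>x\<close>.
  The formulas in one variable that this congruence identifies, read as equations, hold at all
  points of filters of Suszko-reduced models. As these equations do not define truth, some model
  \<open>(A, F)\<close> has a point \<open>a \<notin> F\<close> satisfying all of them, and then the formulas that \<open>x\<close> entails and that take a value in \<open>F\<close> when
  all variables are sent to \<open>a\<close> form a second filter of the quotient, without \<open>x\<close>.

  Theorems guarantee \<open>G\<^sub>0 \<noteq> {}\<close>, hence that \<open>G\<^sub>1\<close> has two elements and is not the whole algebra. In
  large powers one then obtains such a pair of filters in which \<open>F\<^sub>0\<close>, \<open>F\<^sub>1 - F\<^sub>0\<close> and the complement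
  of \<open>F\<^sub>1\<close> all have the same prescribed cardinality (\<open>suszko_reduced_on_pieces\<close>). These three
  cardinalities are all that matters for moving the algebras of \<open>l\<^sub>1\<close> and \<open>l\<^sub>2\<close> to one common set
  \<open>S\<close>, with the same subsets \<open>F\<^sub>0\<close> and \<open>F\<^sub>1\<close>.

  The upper bound is the logic of the two matrices \<open>(S, F\<^sub>0)\<close> and \<open>(S, F\<^sub>1)\<close> over the algebra of all
  finitary operations on \<open>S\<close>. It is not truth-equational, since one algebra carries two reduced
  filters. The difficulty is that the logic has models other than these two, and that in all
  of them the reduct to the language of \<open>l\<^sub>i\<close> has to stay Suszko-reduced
  (\<open>interpretable_full\<close>). Here the abundance of operations helps. For each pair of distinct
  elements of \<open>S\<close>, some filter of \<open>l\<^sub>i\<close> on \<open>S\<close> and some polynomial separate them. An operation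
  that decides membership in that filter, for that pair only, carries the filter into every
  model, and the fact that one of these filters always separates its pair is an
  inference with an equality connective as its conclusion.
\<close>


section \<open>Terms\<close>

primrec subst :: "('v \<Rightarrow> ('f, 'w) tm) \<Rightarrow> ('f, 'v) tm \<Rightarrow> ('f, 'w) tm" where
  "subst \<sigma> (Var x) = \<sigma> x"
| "subst \<sigma> (Fun f ts) = Fun f (map (subst \<sigma>) ts)"

abbreviation vars :: "('f, 'v) tm \<Rightarrow> 'v set" where
  "vars \<equiv> set2_tm"

lemma finite_vars: "finite (vars t)"
  by (induction t) auto

lemma eval_subst: "eval A v (subst \<sigma> t) = eval A (\<lambda>x. eval A v (\<sigma> x)) t"
  by (induction t) (auto simp: comp_def intro!: arg_cong[of _ _ "interp A _"])

lemma eval_rename: "eval A v (subst (Var \<circ> \<rho>) t) = eval A (v \<circ> \<rho>) t"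
  by (simp add: eval_subst comp_def)

lemma eval_cong: "(\<And>x. x \<in> vars t \<Longrightarrow> v x = w x) \<Longrightarrow> eval A v t = eval A w t"
proof (induction t)
  case (Fun f ts)
  have "map (eval A v) ts = map (eval A w) ts"
    using Fun by (intro map_cong refl Fun.IH) auto
  thus ?case by (metis eval.simps(2))
qed auto

lemma terms_iff_vars: "t \<in> terms L X \<longleftrightarrow> t \<in> terms L UNIV \<and> vars t \<subseteq> X"
proof
  show "t \<in> terms L UNIV \<and> vars t \<subseteq> X" if "t \<in> terms L X"
    using that by induction (auto intro: terms.intros)
  have "t \<in> terms L X" if "t \<in> terms L UNIV" "vars t \<subseteq> X"
    using that
  proof induction
    case (Fun f ts)
    thus ?case by (intro terms.Fun) fastforce+
  qed (auto intro: terms.intros)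
  thus "t \<in> terms L UNIV \<and> vars t \<subseteq> X \<Longrightarrow> t \<in> terms L X" by blast
qed

lemma vars_terms: "t \<in> terms L X \<Longrightarrow> x \<in> vars t \<Longrightarrow> x \<in> X"
  using terms_iff_vars[of t L X] by blast

lemma eval_cong_terms:
  "t \<in> terms L X \<Longrightarrow> (\<And>x. x \<in> X \<Longrightarrow> v x = w x) \<Longrightarrow> eval A v t = eval A w t"
  by (rule eval_cong) (simp add: vars_terms)

lemma subst_terms:
  assumes "t \<in> terms L X" and "\<And>x. x \<in> X \<Longrightarrow> \<sigma> x \<in> terms L Y"
  shows "subst \<sigma> t \<in> terms L Y"
  using assms(1) by induction (auto intro!: terms.Fun assms(2))

lemma eval_closed:
  assumes "is_algebra L A" and "t \<in> terms L X" and "\<And>x. x \<in> X \<Longrightarrow> v x \<in> carrier A"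
  shows "eval A v t \<in> carrier A"
  using assms(2)
proof induction
  case (Fun f ts)
  hence "set (map (eval A v) ts) \<subseteq> carrier A" by auto
  thus ?case using assms(1) Fun(1,2) unfolding is_algebra_def by simp
qed (auto intro: assms(3))

lemma hom_eval:
  assumes h: "is_hom L A B h" and A: "is_algebra L A"
    and "t \<in> terms L X" and v: "\<And>x. x \<in> X \<Longrightarrow> v x \<in> carrier A"
  shows "h (eval A v t) = eval B (\<lambda>x. h (v x)) t"
  using assms(3)
proof induction
  case (Fun f ts)
  have "set (map (eval A v) ts) \<subseteq> carrier A"
    using eval_closed[OF A Fun(3), of _ v] v by auto
  hence "h (eval A v (Fun f ts)) = interp B f (map h (map (eval A v) ts))"
    using h Fun unfolding is_hom_def by simp
  also have "map h (map (eval A v) ts) = map (eval B (\<lambda>x. h (v x))) ts"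
    using Fun by simp
  finally show ?case by simp
qed simp

lemma carrier_Fm [simp]: "carrier (Fm L \<kappa>) = terms L {..<\<kappa>}"
  and interp_Fm [simp]: "interp (Fm L \<kappa>) = Fun"
  by (simp_all add: Fm_def)

lemma eval_Fm: "eval (Fm L \<kappa>) = subst"
proof (intro ext)
  fix \<sigma> :: "'v \<Rightarrow> ('b, 'c) tm" and t :: "('b, 'v) tm"
  show "eval (Fm L \<kappa>) \<sigma> t = subst \<sigma> t"
    by (induction t) auto
qed

lemma subst_Var: "subst Var t = t"
  by (induction t) (auto intro: map_idI)

lemma is_algebra_Fm: "{..<\<kappa>} \<noteq> {} \<Longrightarrow> is_algebra L (Fm L \<kappa>)"
  unfolding is_algebra_def by (auto intro!: terms.intros)

lemma is_hom_eval:
  assumes "is_algebra L A" and "\<And>x. x \<in> {..<\<kappa>} \<Longrightarrow> v x \<in> carrier A"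
  shows "is_hom L (Fm L \<kappa>) A (eval A v)"
  using eval_closed[OF assms(1), of _ "{..<\<kappa>}" v] assms(2) unfolding is_hom_def by auto

lemma hom_Fm_eq_eval:
  assumes "is_hom L (Fm L \<kappa>) A h" and "t \<in> terms L {..<\<kappa>}" and "{..<\<kappa>} \<noteq> {}"
  shows "h t = eval A (\<lambda>x. h (Var x)) t"
  using hom_eval[OF assms(1) is_algebra_Fm[OF assms(3)] assms(2), of Var] assms(1)
  by (simp add: eval_Fm subst_Var terms.Var)


section \<open>Polynomials and the Suszko congruence\<close>

text \<open>A unary polynomial function of an algebra is given by a term in which \<open>None\<close> marks the
  argument and \<open>Some c\<close> stands for the parameter \<open>c\<close>. With the parameters serving as their own
  names, composing polynomials requires no renaming of variables.\<close>

definition polys :: "'f language \<Rightarrow> ('f, 'a) algebra \<Rightarrow> ('f, 'a option) tm set" where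
  "polys L A = terms L (insert None (Some ` carrier A))"

definition peval :: "('f, 'a) algebra \<Rightarrow> 'a \<Rightarrow> ('f, 'a option) tm \<Rightarrow> 'a" where
  "peval A a = eval A (case_option a id)"

lemma peval_closed:
  "is_algebra L A \<Longrightarrow> p \<in> polys L A \<Longrightarrow> a \<in> carrier A \<Longrightarrow> peval A a p \<in> carrier A"
  unfolding peval_def polys_def by (erule eval_closed) auto

text \<open>Replacing each parameter by a preimage pulls a polynomial back. Only the parameters, finitely
  many, must lie in the range: an assignment of variables in a model that is larger than the
  formula algebra can reach them, but it cannot be onto.\<close>

lemma poly_lift:
  assumes h: "is_hom L A B h" and A: "is_algebra L A"
    and p: "p \<in> polys L B" and c: "\<And>c. Some c \<in> vars p \<Longrightarrow> c \<in> h ` carrier A"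
  obtains q where "q \<in> polys L A" "\<And>a. a \<in> carrier A \<Longrightarrow> h (peval A a q) = peval B (h a) p"
proof
  define g where "g c = (SOME a. a \<in> carrier A \<and> h a = c)" for c
  have g: "g c \<in> carrier A \<and> h (g c) = c" if "Some c \<in> vars p" for c
    unfolding g_def by (rule someI_ex) (use c[OF that] in auto)
  let ?q = "subst (\<lambda>x. Var (map_option g x)) p"
  have "p \<in> terms L (vars p)"
    using p terms_iff_vars[of p L] unfolding polys_def by blast
  thus q: "?q \<in> polys L A"
    unfolding polys_def
  proof (rule subst_terms)
    fix x assume x: "x \<in> vars p"
    show "Var (map_option g x) \<in> terms L (insert None (Some ` carrier A))"
    proof (cases x)
      case (Some c)
      thus ?thesis using g[of c] x by (auto intro!: terms.Var)
    qed (auto intro!: terms.Var)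
  qed
  fix a assume a: "a \<in> carrier A"
  have "h (peval A a ?q) = eval B (\<lambda>x. h (case_option a id x)) ?q"
    unfolding peval_def
    by (rule hom_eval[OF h A q[unfolded polys_def]]) (use a in auto)
  also have "\<dots> = peval B (h a) p"
    unfolding peval_def eval_subst
    by (rule eval_cong) (auto split: option.splits simp: g)
  finally show "h (peval A a ?q) = peval B (h a) p" .
qed

lemma poly_push:
  assumes h: "is_hom L A B h" and A: "is_algebra L A" and p: "p \<in> polys L A"
  obtains q where "q \<in> polys L B" "\<And>a. a \<in> carrier A \<Longrightarrow> peval B (h a) q = h (peval A a p)"
proof
  let ?q = "subst (\<lambda>x. Var (map_option h x)) p"
  show "?q \<in> polys L B"
    using p unfolding polys_def
    by (rule subst_terms) (use h in \<open>auto intro!: terms.Var simp: is_hom_def\<close>)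
  fix a assume a: "a \<in> carrier A"
  have "h (peval A a p) = eval B (\<lambda>x. h (case_option a id x)) p"
    unfolding peval_def
    by (rule hom_eval[OF h A p[unfolded polys_def]]) (use a in auto)
  also have "\<dots> = peval B (h a) ?q"
    unfolding peval_def eval_subst by (rule eval_cong) (auto split: option.splits)
  finally show "peval B (h a) ?q = h (peval A a p)" by simp
qed

text \<open>Indistinguishability by polynomials is a congruence because replacing the arguments of an
  operation one by one only composes the polynomial with a translation of the algebra.\<close>

lemma Leibniz_iff_polys:
  assumes A: "is_algebra L A" and F: "F \<subseteq> carrier A"
  shows "(a, b) \<in> Leibniz_congruence L A F \<longleftrightarrow> a \<in> carrier A \<and> b \<in> carrier A \<and>
    (\<forall>p\<in>polys L A. peval A a p \<in> F \<longleftrightarrow> peval A b p \<in> F)"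
proof
  let ?\<Omega> = "Leibniz_congruence L A F"
  have cong: "congruence L A ?\<Omega>" and comp: "compatible ?\<Omega> F"
    using Leibniz_congruence_greatest[OF A F] by auto
  have eq: "equiv (carrier A) ?\<Omega>"
    using cong by (simp add: congruence_def)
  assume ab: "(a, b) \<in> ?\<Omega>"
  hence car: "a \<in> carrier A" "b \<in> carrier A"
    using eq by (auto simp: equiv_def)
  have pp: "(peval A a p, peval A b p) \<in> ?\<Omega>" if "p \<in> polys L A" for p
    using that unfolding polys_def
  proof induction
    case (Var x)
    thus ?case
      using ab eq by (auto simp: peval_def equiv_def refl_on_def)
  next
    case (Fun f ts)
    have "list_all2 (\<lambda>a b. (a, b) \<in> ?\<Omega>) (map (peval A a) ts) (map (peval A b) ts)"
      using Fun by (auto simp: list_all2_conv_all_nth)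
    thus ?case
      using cong Fun(1,2) by (simp add: congruence_def peval_def)
  qed
  have "(y, x) \<in> ?\<Omega>" if "(x, y) \<in> ?\<Omega>" for x y
    using eq that by (auto simp: equiv_def sym_def)
  thus "a \<in> carrier A \<and> b \<in> carrier A \<and> (\<forall>p\<in>polys L A. peval A a p \<in> F \<longleftrightarrow> peval A b p \<in> F)"
    using pp comp car unfolding compatible_def by blast
next
  let ?R = "{(a, b). a \<in> carrier A \<and> b \<in> carrier A \<and>
    (\<forall>p\<in>polys L A. peval A a p \<in> F \<longleftrightarrow> peval A b p \<in> F)}"
  have eq: "equiv (carrier A) ?R"
    by (rule equivI) (auto simp: refl_on_def sym_def trans_def)
  have step: "(interp A f (xs @ c # ys), interp A f (xs @ d # ys)) \<in> ?R"
    if f: "f \<in> syms L" and cd: "(c, d) \<in> ?R" and xs: "set xs \<subseteq> carrier A"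
      and ys: "set ys \<subseteq> carrier A" and n: "length xs + Suc (length ys) = arity L f" for f c d xs ys
  proof -
    have "peval A (interp A f (xs @ c # ys)) p \<in> F \<longleftrightarrow> peval A (interp A f (xs @ d # ys)) p \<in> F"
      if p: "p \<in> polys L A" for p
    proof -
      define t where "t = Fun f (map (Var \<circ> Some) xs @ Var None # map (Var \<circ> Some) ys)"
      have t: "t \<in> polys L A"
        unfolding t_def polys_def using f n xs ys
        by (intro terms.Fun) (auto intro!: terms.Var)
      let ?q = "subst (\<lambda>x. if x = None then t else Var x) p"
      have q: "?q \<in> polys L A"
        using p t unfolding polys_def by (elim subst_terms) (auto intro: terms.Var)
      have "peval A z ?q = peval A (interp A f (xs @ z # ys)) p" for z
        unfolding peval_def eval_subst
        by (rule eval_cong) (auto simp: t_def comp_def split: option.splits)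
      moreover have "peval A c ?q \<in> F \<longleftrightarrow> peval A d ?q \<in> F"
        using q cd by blast
      ultimately show ?thesis by simp
    qed
    moreover have "interp A f (xs @ z # ys) \<in> carrier A" if "z \<in> carrier A" for z
      using A f xs ys n that unfolding is_algebra_def by auto
    ultimately show ?thesis
      using cd by auto
  qed
  have all: "(interp A f (xs @ as), interp A f (xs @ bs)) \<in> ?R"
    if f: "f \<in> syms L" and l: "list_all2 (\<lambda>a b. (a, b) \<in> ?R) as bs"
      and "set xs \<subseteq> carrier A" "length xs + length as = arity L f" for f xs as bs
    using l that(3,4)
  proof (induction arbitrary: xs rule: list_all2_induct)
    case Nil
    thus ?case using A f unfolding is_algebra_def by auto
  next
    case (Cons a as b bs)
    have car: "b \<in> carrier A" "set as \<subseteq> carrier A"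
      using Cons.hyps by (auto simp: list_all2_conv_all_nth set_conv_nth)
    have "(interp A f (xs @ a # as), interp A f (xs @ b # as)) \<in> ?R"
      using step[OF f Cons.hyps(1), of xs as] Cons.prems car by auto
    moreover have "(interp A f ((xs @ [b]) @ as), interp A f ((xs @ [b]) @ bs)) \<in> ?R"
      using Cons.prems car by (intro Cons.IH) auto
    ultimately show ?case by simp
  qed
  have "congruence L A ?R"
    unfolding congruence_def using eq all[of _ _ _ "[]", unfolded append_Nil list.set list.size]
    by (metis (no_types, lifting) add_0 empty_subsetI)
  moreover have "compatible ?R F"
  proof -
    have "Var None \<in> polys L A"
      unfolding polys_def by (auto intro: terms.Var)
    moreover have "peval A z (Var None) = z" for z
      by (simp add: peval_def)
    ultimately show ?thesis
      unfolding compatible_def by auto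
  qed
  ultimately have "?R \<subseteq> Leibniz_congruence L A F"
    using Leibniz_congruence_greatest(3)[OF A F] by blast
  moreover assume "a \<in> carrier A \<and> b \<in> carrier A \<and>
    (\<forall>p\<in>polys L A. peval A a p \<in> F \<longleftrightarrow> peval A b p \<in> F)"
  ultimately show "(a, b) \<in> Leibniz_congruence L A F" by blast
qed

text \<open>The complement of the Suszko congruence, in terms of polynomials. In this form it
  is witnessed by a single filter and a single term, both of which can be pulled back along
  surjective homomorphisms.\<close>

definition distinguished :: "'u::wellorder logic \<Rightarrow> ('u, 'a) algebra \<Rightarrow> 'a set \<Rightarrow> 'a \<Rightarrow> 'a \<Rightarrow> bool" where
  "distinguished l A F a b \<longleftrightarrow> (\<exists>G p. deductive_filter l A G \<and> F \<subseteq> G \<and> p \<in> polys (lang l) A \<and>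
     (peval A a p \<in> G) \<noteq> (peval A b p \<in> G))"

lemma filter_subset: "deductive_filter l A F \<Longrightarrow> F \<subseteq> carrier A"
  by (simp add: deductive_filter_def)

lemma Suszko_iff_distinguished:
  assumes A: "is_algebra (lang l) A" and F: "deductive_filter l A F"
  shows "(a, b) \<in> Suszko_congruence l A F \<longleftrightarrow>
    a \<in> carrier A \<and> b \<in> carrier A \<and> \<not> distinguished l A F a b"
proof -
  have "(a, b) \<in> Suszko_congruence l A F \<longleftrightarrow>
      (\<forall>G. deductive_filter l A G \<and> F \<subseteq> G \<longrightarrow> (a, b) \<in> Leibniz_congruence (lang l) A G)"
    unfolding Suszko_congruence_def by blast
  also have "\<dots> \<longleftrightarrow> (\<forall>G. deductive_filter l A G \<and> F \<subseteq> G \<longrightarrow> a \<in> carrier A \<and> b \<in> carrier A \<and>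
      (\<forall>p\<in>polys (lang l) A. peval A a p \<in> G \<longleftrightarrow> peval A b p \<in> G))"
    using Leibniz_iff_polys[OF A filter_subset] by (intro all_cong1 imp_cong refl) blast
  also have "\<dots> \<longleftrightarrow> a \<in> carrier A \<and> b \<in> carrier A \<and> \<not> distinguished l A F a b"
    using F unfolding distinguished_def by blast
  finally show ?thesis .
qed

lemma Suszko_compatible:
  assumes "is_algebra (lang l) A" and "deductive_filter l A F"
    and "deductive_filter l A G" "F \<subseteq> G" and "(a, b) \<in> Suszko_congruence l A F" "a \<in> G"
  shows "b \<in> G"
proof -
  have "Var None \<in> polys (lang l) A"
    by (auto simp: polys_def intro: terms.Var)
  hence "peval A a (Var None) \<in> G \<longleftrightarrow> peval A b (Var None) \<in> G"
    using assms(3-5) unfolding Suszko_iff_distinguished[OF assms(1,2)] distinguished_def by blast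
  thus ?thesis
    using assms(6) by (simp add: peval_def)
qed

text \<open>The matrices in \<open>Mod\<^sup>\<equiv>(l)\<close>, up to the size and the type of the carrier. Allowing an
  arbitrary type lets filters on formula algebras, quotients and powers be treated alike.\<close>

definition suszko_reduced :: "'u::wellorder logic \<Rightarrow> ('u, 'a) algebra \<Rightarrow> 'a set \<Rightarrow> bool" where
  "suszko_reduced l A F \<longleftrightarrow> is_algebra (lang l) A \<and> deductive_filter l A F \<and>
     (\<forall>a\<in>carrier A. \<forall>b\<in>carrier A. a \<noteq> b \<longrightarrow> distinguished l A F a b)"

lemma Mod_Suszko_iff: "(A, F) \<in> Mod_Suszko l \<longleftrightarrow> suszko_reduced l A F \<and> small (carrier A)"
proof (cases "is_algebra (lang l) A \<and> deductive_filter l A F")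
  case True
  have "\<not> distinguished l A F a a" for a
    by (simp add: distinguished_def)
  hence "Suszko_congruence l A F = Id_on (carrier A) \<longleftrightarrow>
    (\<forall>a\<in>carrier A. \<forall>b\<in>carrier A. a \<noteq> b \<longrightarrow> distinguished l A F a b)"
    unfolding set_eq_iff split_paired_All Id_on_iff using True
    by (simp only: Suszko_iff_distinguished) blast
  thus ?thesis
    using True unfolding Mod_Suszko_def suszko_reduced_def by (simp add: conj_commute)
qed (auto simp: Mod_Suszko_def suszko_reduced_def)


section \<open>Filters along homomorphisms\<close>

lemma nvars_infinite: "is_logic l \<Longrightarrow> infinite {..<nvars l}"
  by (simp add: is_logic_def infinite_cardinal_def)

lemma nvars_nonempty: "is_logic l \<Longrightarrow> {..<nvars l} \<noteq> {}"
  using nvars_infinite by fastforce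

lemma
  assumes "is_logic l"
  shows entails_formulas: "entails l \<Gamma> \<phi> \<Longrightarrow>
      \<Gamma> \<subseteq> terms (lang l) {..<nvars l} \<and> \<phi> \<in> terms (lang l) {..<nvars l}"
    and entails_refl: "\<Gamma> \<subseteq> terms (lang l) {..<nvars l} \<Longrightarrow> \<gamma> \<in> \<Gamma> \<Longrightarrow> entails l \<Gamma> \<gamma>"
    and entails_cut: "\<Gamma> \<subseteq> terms (lang l) {..<nvars l} \<Longrightarrow> (\<And>\<delta>. \<delta> \<in> \<Delta> \<Longrightarrow> entails l \<Gamma> \<delta>) \<Longrightarrow>
      entails l \<Delta> \<phi> \<Longrightarrow> entails l \<Gamma> \<phi>"
proof -
  have "consequence_relation (terms (lang l) {..<nvars l}) (entails l)"
    using assms by (simp add: is_logic_def)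
  note * = this[unfolded consequence_relation_def]
  show "entails l \<Gamma> \<phi> \<Longrightarrow> \<Gamma> \<subseteq> terms (lang l) {..<nvars l} \<and> \<phi> \<in> terms (lang l) {..<nvars l}"
    using *[THEN conjunct1] by simp
  show "\<Gamma> \<subseteq> terms (lang l) {..<nvars l} \<Longrightarrow> \<gamma> \<in> \<Gamma> \<Longrightarrow> entails l \<Gamma> \<gamma>"
    using *[THEN conjunct2, THEN conjunct1] by simp
  show "entails l \<Gamma> \<phi>" if "\<Gamma> \<subseteq> terms (lang l) {..<nvars l}" "\<And>\<delta>. \<delta> \<in> \<Delta> \<Longrightarrow> entails l \<Gamma> \<delta>" "entails l \<Delta> \<phi>"
    using *[THEN conjunct2, THEN conjunct2, rule_format, of \<Gamma> \<Delta> \<phi>] that by simp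
qed

lemma entails_subst:
  assumes "is_logic l" "is_hom (lang l) (formula_algebra l) (formula_algebra l) \<sigma>" "entails l \<Gamma> \<phi>"
  shows "entails l (\<sigma> ` \<Gamma>) (\<sigma> \<phi>)"
  using assms unfolding is_logic_def by simp

lemma filter_eval:
  assumes A: "is_algebra (lang l) A" and F: "deductive_filter l A F" and e: "entails l \<Gamma> \<phi>"
    and v: "v ` {..<nvars l} \<subseteq> carrier A" and sub: "eval A v ` \<Gamma> \<subseteq> F"
  shows "eval A v \<phi> \<in> F"
proof -
  have "is_hom (lang l) (formula_algebra l) A (eval A v)"
    using v by (intro is_hom_eval[OF A]) auto
  thus ?thesis
    using F e sub unfolding deductive_filter_def by blast
qed

lemma filterI:
  assumes l: "is_logic l" and F: "F \<subseteq> carrier A"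
    and *: "\<And>\<Gamma> \<phi> v. entails l \<Gamma> \<phi> \<Longrightarrow> v ` {..<nvars l} \<subseteq> carrier A \<Longrightarrow> eval A v ` \<Gamma> \<subseteq> F \<Longrightarrow>
      eval A v \<phi> \<in> F"
  shows "deductive_filter l A F"
proof -
  have "h \<phi> \<in> F"
    if e: "entails l \<Gamma> \<phi>" and h: "is_hom (lang l) (formula_algebra l) A h" and sub: "h ` \<Gamma> \<subseteq> F" for \<Gamma> \<phi> h
  proof -
    note h_eval = hom_Fm_eq_eval[OF h _ nvars_nonempty[OF l]]
    have "eval A (\<lambda>x. h (Var x)) \<phi> \<in> F"
    proof (rule *[OF e])
      show "(\<lambda>x. h (Var x)) ` {..<nvars l} \<subseteq> carrier A"
        using h by (auto simp: is_hom_def intro!: terms.Var)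
      show "eval A (\<lambda>x. h (Var x)) ` \<Gamma> \<subseteq> F"
      proof
        fix y assume "y \<in> eval A (\<lambda>x. h (Var x)) ` \<Gamma>"
        then obtain \<gamma> where \<gamma>: "\<gamma> \<in> \<Gamma>" "y = eval A (\<lambda>x. h (Var x)) \<gamma>" by blast
        hence "y = h \<gamma>" using h_eval entails_formulas[OF l e] by (metis subsetD)
        thus "y \<in> F" using \<gamma> sub by blast
      qed
    qed
    thus ?thesis
      using h_eval entails_formulas[OF l e] by metis
  qed
  thus ?thesis
    using F unfolding deductive_filter_def by blast
qed

lemma is_hom_comp:
  assumes h: "is_hom L A B h" and g: "is_hom L B C g"
  shows "is_hom L A C (g \<circ> h)"
  unfolding is_hom_def
proof (intro conjI ballI allI impI)
  show "(g \<circ> h) ` carrier A \<subseteq> carrier C"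
    using assms unfolding is_hom_def by (auto simp: image_subset_iff)
  fix f as assume f: "f \<in> syms L" and as: "length as = arity L f \<and> set as \<subseteq> carrier A"
  have "set (map h as) \<subseteq> carrier B"
    using h as unfolding is_hom_def by (auto simp: image_subset_iff subset_iff)
  thus "(g \<circ> h) (interp A f as) = interp C f (map (g \<circ> h) as)"
    using assms f as unfolding is_hom_def by (simp flip: map_map)
qed

lemma filter_vimage:
  assumes l: "is_logic l" and h: "is_hom (lang l) A B h" and G: "deductive_filter l B G"
  shows "deductive_filter l A {a \<in> carrier A. h a \<in> G}"
proof -
  have "g \<phi> \<in> carrier A \<and> h (g \<phi>) \<in> G"
    if e: "entails l \<Gamma> \<phi>" and g: "is_hom (lang l) (formula_algebra l) A g"
      and sub: "g ` \<Gamma> \<subseteq> {a \<in> carrier A. h a \<in> G}" for \<Gamma> \<phi> g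
  proof
    show "g \<phi> \<in> carrier A"
      using g entails_formulas[OF l e] unfolding is_hom_def by auto
    have "(h \<circ> g) ` \<Gamma> \<subseteq> G" using sub by auto
    hence "(h \<circ> g) \<phi> \<in> G"
      using e is_hom_comp[OF g h] G unfolding deductive_filter_def by blast
    thus "h (g \<phi>) \<in> G" by simp
  qed
  thus ?thesis
    unfolding deductive_filter_def by blast
qed

text \<open>Along a surjection the converse holds too, because assignments lift.\<close>

lemma filter_of_vimage:
  assumes l: "is_logic l" and A: "is_algebra (lang l) A" and B: "is_algebra (lang l) B"
    and h: "is_hom (lang l) A B h" and surj: "h ` carrier A = carrier B"
    and G: "G \<subseteq> carrier B" and F: "deductive_filter l A {a \<in> carrier A. h a \<in> G}"
  shows "deductive_filter l B G"
proof (rule filterI[OF l G])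
  fix \<Gamma> \<phi> v
  assume e: "entails l \<Gamma> \<phi>" and v: "v ` {..<nvars l} \<subseteq> carrier B" and sub: "eval B v ` \<Gamma> \<subseteq> G"
  define w where "w x = inv_into (carrier A) h (v x)" for x
  have w: "w x \<in> carrier A" "h (w x) = v x" if "x \<in> {..<nvars l}" for x
  proof -
    have "v x \<in> h ` carrier A" using v that surj by blast
    thus "w x \<in> carrier A" "h (w x) = v x"
      unfolding w_def by (rule inv_into_into, rule f_inv_into_f)
  qed
  have hom: "is_hom (lang l) (formula_algebra l) A (eval A w)"
    using w by (intro is_hom_eval[OF A]) auto
  have ev: "h (eval A w \<psi>) = eval B v \<psi>" if "\<psi> \<in> terms (lang l) {..<nvars l}" for \<psi>
  proof -
    have "h (eval A w \<psi>) = eval B (\<lambda>x. h (w x)) \<psi>"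
      using w by (intro hom_eval[OF h A that]) auto
    also have "\<dots> = eval B v \<psi>"
      by (rule eval_cong_terms[OF that w(2)])
    finally show ?thesis .
  qed
  have "eval A w ` \<Gamma> \<subseteq> {a \<in> carrier A. h a \<in> G}"
    using entails_formulas[OF l e] ev sub hom unfolding is_hom_def by fastforce
  hence "h (eval A w \<phi>) \<in> G"
    using F e hom unfolding deductive_filter_def by blast
  thus "eval B v \<phi> \<in> G"
    using ev entails_formulas[OF l e] by simp
qed

lemma suszko_reduced_mono:
  "suszko_reduced l A F \<Longrightarrow> deductive_filter l A F' \<Longrightarrow> F' \<subseteq> F \<Longrightarrow> suszko_reduced l A F'"
  unfolding suszko_reduced_def distinguished_def by (meson order_trans)

text \<open>A separating filter and a separating polynomial can be pulled back along a homomorphism onto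
  another matrix. This covers isomorphisms and, by way of the projections, products.\<close>

lemma suszko_reducedI:
  assumes l: "is_logic l" and A: "is_algebra (lang l) A" and F: "deductive_filter l A F"
    and sep: "\<And>a b. a \<in> carrier A \<Longrightarrow> b \<in> carrier A \<Longrightarrow> a \<noteq> b \<Longrightarrow>
      \<exists>B G h. suszko_reduced l (B :: ('u::wellorder, 'b) algebra) G \<and> is_hom (lang l) A B h \<and>
        h ` carrier A = carrier B \<and> h ` F \<subseteq> G \<and> h a \<noteq> h b"
  shows "suszko_reduced l A F"
  unfolding suszko_reduced_def
proof (intro conjI ballI impI A F)
  fix a b assume ab: "a \<in> carrier A" "b \<in> carrier A" "a \<noteq> b"
  obtain B :: "('u, 'b) algebra" and G h where B: "suszko_reduced l B G" and h: "is_hom (lang l) A B h"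
    and surj: "h ` carrier A = carrier B" and FG: "h ` F \<subseteq> G" and hab: "h a \<noteq> h b"
    using sep[OF ab] by blast
  obtain G' p where G': "deductive_filter l B G'" "G \<subseteq> G'" and p: "p \<in> polys (lang l) B"
    and pne: "(peval B (h a) p \<in> G') \<noteq> (peval B (h b) p \<in> G')"
    using B hab ab surj unfolding suszko_reduced_def distinguished_def by (metis imageI)
  have "c \<in> h ` carrier A" if "Some c \<in> vars p" for c
    using vars_terms[OF p[unfolded polys_def] that] surj by auto
  then obtain q where q: "q \<in> polys (lang l) A"
    "\<And>a. a \<in> carrier A \<Longrightarrow> h (peval A a q) = peval B (h a) p"
    using poly_lift[OF h A p] by blast
  let ?G = "{a \<in> carrier A. h a \<in> G'}"
  have "deductive_filter l A ?G"
    by (rule filter_vimage[OF l h G'(1)])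
  moreover have "F \<subseteq> ?G"
    using F FG G'(2) unfolding deductive_filter_def by auto
  moreover have "(peval A a q \<in> ?G) \<noteq> (peval A b q \<in> ?G)"
    using pne q ab peval_closed[OF A q(1)] by simp
  ultimately show "distinguished l A F a b"
    using q(1) unfolding distinguished_def by blast
qed


lemma filter_theory:
  assumes l: "is_logic l" and \<Gamma>: "\<Gamma> \<subseteq> terms (lang l) {..<nvars l}"
  shows "deductive_filter l (formula_algebra l) {\<phi>. entails l \<Gamma> \<phi>}"
proof -
  have "entails l \<Gamma> (h \<phi>)"
    if "entails l \<Delta> \<phi>" "is_hom (lang l) (formula_algebra l) (formula_algebra l) h"
      "h ` \<Delta> \<subseteq> {\<phi>. entails l \<Gamma> \<phi>}" for \<Delta> \<phi> h
    by (rule entails_cut[OF l \<Gamma> _ entails_subst[OF l that(2,1)]]) (use that(3) in blast)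
  thus ?thesis
    unfolding deductive_filter_def using entails_formulas[OF l] by auto
qed

lemma filter_Int:
  "deductive_filter l A F \<Longrightarrow> deductive_filter l A G \<Longrightarrow> deductive_filter l A (F \<inter> G)"
  unfolding deductive_filter_def by (simp add: le_infI1) blast

lemma filter_nonempty:
  assumes l: "is_logic l" "has_theorems l" and A: "is_algebra (lang l) A" and F: "deductive_filter l A F"
  shows "F \<noteq> {}"
proof -
  obtain \<phi> where "entails l {} \<phi>"
    using l(2) by (auto simp: has_theorems_def)
  moreover obtain a where "a \<in> carrier A"
    using A by (auto simp: is_algebra_def)
  ultimately have "eval A (\<lambda>_. a) \<phi> \<in> F"
    by (intro filter_eval[OF A F]) auto
  thus ?thesis by blast
qed


section \<open>Failure of truth-equationality\<close>

lemma ex_fresh_names: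
  assumes "infinite X" "finite Y" "finite C"
  obtains \<rho> where "inj_on \<rho> C" "\<rho> ` C \<subseteq> X - Y"
proof -
  obtain B where B: "finite B" "card B = card C" "B \<subseteq> X - Y"
    using infinite_arbitrarily_large[of "X - Y"] assms(1,2) by (metis Diff_infinite_finite)
  then obtain \<rho> where "bij_betw \<rho> C B"
    using finite_same_card_bij[OF assms(3) B(1)] by metis
  thus ?thesis
    using that B(3) by (auto simp: bij_betw_def)
qed

lemma card_of_finite_le:
  assumes "finite C" "infinite X"
  shows "|C| \<le>o |X|"
proof -
  obtain \<rho> where "inj_on \<rho> C" "\<rho> ` C \<subseteq> X - {}"
    using ex_fresh_names[OF assms(2) finite.emptyI assms(1)] .
  thus ?thesis
    unfolding card_of_ordLeq[symmetric] by blast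
qed

abbreviation consequences_of_var :: "'u::wellorder logic \<Rightarrow> 'u \<Rightarrow> ('u, 'u) tm set" where
  "consequences_of_var l x \<equiv> {\<phi>. entails l {Var x} \<phi>}"

lemma consequences_of_var_least:
  assumes "x \<in> {..<nvars l}" and "deductive_filter l (formula_algebra l) G" and "Var x \<in> G"
  shows "consequences_of_var l x \<subseteq> G"
proof
  fix \<phi> assume "\<phi> \<in> consequences_of_var l x"
  moreover have "is_hom (lang l) (formula_algebra l) (formula_algebra l) id"
    by (simp add: is_hom_def)
  ultimately have "id \<phi> \<in> G"
    using assms(2,3) unfolding deductive_filter_def by (metis (no_types, lifting) image_id id_apply
      empty_subsetI insert_subset mem_Collect_eq)
  thus "\<phi> \<in> G" by simp
qed

text \<open>The parameters of a polynomial of the model can be named by variables that occur in neither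
  formula, which turns the polynomial into one of the formula algebra. The filter pulls back to a
  theory that contains \<open>x\<close>, hence everything that \<open>x\<close> entails.\<close>

lemma Suszko_var_interchangeable:
  assumes l: "is_logic l" and x: "x \<in> {..<nvars l}"
    and \<theta>: "(\<phi>, \<psi>) \<in> Suszko_congruence l (formula_algebra l) (consequences_of_var l x)"
    and A: "is_algebra (lang l) A" and G: "deductive_filter l A G"
    and w: "w ` {..<nvars l} \<subseteq> carrier A" and wx: "w x \<in> G" and p: "p \<in> polys (lang l) A"
  shows "peval A (eval A w \<phi>) p \<in> G \<longleftrightarrow> peval A (eval A w \<psi>) p \<in> G"
proof -
  let ?Fm = "formula_algebra l" and ?T = "consequences_of_var l x"
  have Fm: "is_algebra (lang l) ?Fm"
    by (rule is_algebra_Fm[OF nvars_nonempty[OF l]])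
  have vx: "Var x \<in> terms (lang l) {..<nvars l}"
    using x by (rule terms.Var)
  have T: "deductive_filter l ?Fm ?T"
    using vx by (intro filter_theory[OF l]) auto
  have \<phi>\<psi>: "\<phi> \<in> carrier ?Fm" "\<psi> \<in> carrier ?Fm" and nd: "\<not> distinguished l ?Fm ?T \<phi> \<psi>"
    using \<theta> unfolding Suszko_iff_distinguished[OF Fm T] by auto
  define C where "C = {c. Some c \<in> vars p}"
  have C: "finite C" "C \<subseteq> carrier A"
  proof -
    have "C \<subseteq> the ` vars p"
      unfolding C_def by force
    thus "finite C"
      by (rule finite_subset) (simp add: finite_vars)
    show "C \<subseteq> carrier A"
      unfolding C_def using vars_terms[OF p[unfolded polys_def]] by auto
  qed
  define V where "V = vars \<phi> \<union> vars \<psi> \<union> {x}"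
  have "finite V" by (simp add: V_def finite_vars)
  then obtain \<rho> where \<rho>: "inj_on \<rho> C" "\<rho> ` C \<subseteq> {..<nvars l} - V"
    using ex_fresh_names[OF nvars_infinite[OF l] _ C(1)] by blast
  \<comment> \<open>Changing \<open>w\<close> at variables that do not occur makes its range contain all parameters of \<open>p\<close>.\<close>
  define w' where "w' y = (if y \<in> \<rho> ` C then inv_into C \<rho> y else w y)" for y
  have w': "w' y \<in> carrier A" if "y \<in> {..<nvars l}" for y
    using that w C(2) inv_into_into[of y \<rho> C] unfolding w'_def by auto
  have w'V: "w' y = w y" if "y \<in> V" for y
    using that \<rho>(2) unfolding w'_def by auto
  define h where "h = eval A w'"
  have h: "is_hom (lang l) ?Fm A h"
    unfolding h_def by (rule is_hom_eval[OF A w'])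
  have "c \<in> h ` carrier ?Fm" if "Some c \<in> vars p" for c
  proof
    have c: "c \<in> C" using that by (simp add: C_def)
    show "c = h (Var (\<rho> c))"
      using c \<rho>(1) by (simp add: h_def w'_def)
    show "Var (\<rho> c) \<in> carrier ?Fm"
      using c \<rho>(2) by (auto intro: terms.Var)
  qed
  then obtain q where q: "q \<in> polys (lang l) ?Fm"
    "\<And>\<chi>. \<chi> \<in> carrier ?Fm \<Longrightarrow> h (peval ?Fm \<chi> q) = peval A (h \<chi>) p"
    using poly_lift[OF h Fm p] by blast
  let ?G = "{\<chi> \<in> carrier ?Fm. h \<chi> \<in> G}"
  have G': "deductive_filter l ?Fm ?G"
    by (rule filter_vimage[OF l h G])
  have "Var x \<in> ?G"
    using vx wx w'V[of x] by (simp add: h_def V_def)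
  hence "?T \<subseteq> ?G"
    by (rule consequences_of_var_least[OF x G'])
  hence "peval ?Fm \<phi> q \<in> ?G \<longleftrightarrow> peval ?Fm \<psi> q \<in> ?G"
    using nd G' q(1) unfolding distinguished_def by blast
  moreover have "h \<phi> = eval A w \<phi>" "h \<psi> = eval A w \<psi>"
    unfolding h_def by (intro eval_cong w'V; simp add: V_def)+
  ultimately show ?thesis
    using q(2) \<phi>\<psi> peval_closed[OF Fm q(1)] by simp
qed

text \<open>The equations in one variable given by this congruence hold throughout every filter of a
  Suszko-reduced model. Hence a failure of truth-equationality must come from a point outside
  the filter that satisfies all of them.\<close>

lemma not_truth_equationalE:
  assumes l: "is_logic l" and nte: "\<not> truth_equational l" and x: "x \<in> {..<nvars l}"
  obtains A F a where "(A, F) \<in> Mod_Suszko l" "a \<in> carrier A" "a \<notin> F"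
    "\<And>\<phi> \<psi>. (\<phi>, \<psi>) \<in> Suszko_congruence l (formula_algebra l) (consequences_of_var l x) \<Longrightarrow>
      eval A (\<lambda>_. a) \<phi> = eval A (\<lambda>_. a) \<psi>"
proof -
  let ?Fm = "formula_algebra l" and ?T = "consequences_of_var l x"
  let ?\<theta> = "Suszko_congruence l ?Fm ?T" and ?x = "subst (\<lambda>_::unit. Var x)"
  let ?U = "terms (lang l) (UNIV :: unit set)"
  have Fm: "is_algebra (lang l) ?Fm"
    by (rule is_algebra_Fm[OF nvars_nonempty[OF l]])
  have vx: "Var x \<in> terms (lang l) {..<nvars l}"
    using x by (rule terms.Var)
  have T: "deductive_filter l ?Fm ?T"
    using vx by (intro filter_theory[OF l]) auto
  have xT: "Var x \<in> ?T"
    using entails_refl[OF l, of "{Var x}"] vx by simp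
  define E where "E = {(s, t). s \<in> ?U \<and> t \<in> ?U \<and> (?x s, ?x t) \<in> ?\<theta>}"
  let ?P = "\<lambda>A F a. a \<in> F \<longleftrightarrow> (\<forall>(s, t) \<in> E. eval A (\<lambda>_. a) s = eval A (\<lambda>_. a) t)"
  have E: "E \<subseteq> ?U \<times> ?U"
    unfolding E_def by auto
  have "\<not> (\<forall>(A, F)\<in>Mod_Suszko l. \<forall>a\<in>carrier A. ?P A F a)"
  proof
    assume "\<forall>(A, F)\<in>Mod_Suszko l. \<forall>a\<in>carrier A. ?P A F a"
    with E have "truth_equational l"
      unfolding truth_equational_def by (intro exI[of _ E] conjI)
    thus False using nte by simp
  qed
  then obtain A F a where M: "(A, F) \<in> Mod_Suszko l" and a: "a \<in> carrier A"
    and ne: "\<not> ?P A F a"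
    unfolding Ball_def split_paired_All case_prod_conv by metis
  have red: "suszko_reduced l A F"
    using M by (simp add: Mod_Suszko_iff)
  hence A: "is_algebra (lang l) A"
    by (simp add: suszko_reduced_def)
  have valid: "eval A (\<lambda>_. a) s = eval A (\<lambda>_. a) t" if "a \<in> F" "(s, t) \<in> E" for s t
  proof (rule ccontr)
    have st: "s \<in> ?U" "t \<in> ?U" "(?x s, ?x t) \<in> ?\<theta>"
      using that(2) by (auto simp: E_def)
    have ev: "eval A (\<lambda>_. a) (?x u) = eval A (\<lambda>_. a) u" for u
      by (simp add: eval_subst)
    assume "eval A (\<lambda>_. a) s \<noteq> eval A (\<lambda>_. a) t"
    hence "distinguished l A F (eval A (\<lambda>_. a) s) (eval A (\<lambda>_. a) t)"
      using red eval_closed[OF A st(1), of "\<lambda>_. a"] eval_closed[OF A st(2), of "\<lambda>_. a"] a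
      unfolding suszko_reduced_def by simp
    then obtain G p where "deductive_filter l A G" "F \<subseteq> G" "p \<in> polys (lang l) A"
      "(peval A (eval A (\<lambda>_. a) s) p \<in> G) \<noteq> (peval A (eval A (\<lambda>_. a) t) p \<in> G)"
      unfolding distinguished_def by blast
    thus False
      using Suszko_var_interchangeable[OF l x st(3) A, of G "\<lambda>_. a" p] that(1) a ev by auto
  qed
  show ?thesis
  proof (rule that[OF M a])
    show aF: "a \<notin> F"
      using ne valid by blast
    fix \<phi> \<psi> assume \<theta>: "(\<phi>, \<psi>) \<in> ?\<theta>"
    let ?u = "subst (\<lambda>_. Var ())"
    have \<phi>\<psi>: "\<phi> \<in> carrier ?Fm" "\<psi> \<in> carrier ?Fm"
      using \<theta> unfolding Suszko_iff_distinguished[OF Fm T] by auto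
    have xu: "?x (?u \<chi>) = eval ?Fm (\<lambda>_. Var x) \<chi>" for \<chi>
      using eval_subst[of ?Fm "\<lambda>_. Var x" "\<lambda>_. Var ()" \<chi>] by (simp add: eval_Fm)
    have "(?x (?u \<phi>), ?x (?u \<psi>)) \<in> ?\<theta>"
      unfolding Suszko_iff_distinguished[OF Fm T]
    proof (intro conjI)
      have car: "?x (?u \<chi>) \<in> carrier ?Fm" if "\<chi> \<in> carrier ?Fm" for \<chi>
        unfolding xu using eval_closed[OF Fm that[unfolded carrier_Fm]] vx by simp
      show "?x (?u \<phi>) \<in> carrier ?Fm" "?x (?u \<psi>) \<in> carrier ?Fm"
        by (rule car[OF \<phi>\<psi>(1)], rule car[OF \<phi>\<psi>(2)])
      show "\<not> distinguished l ?Fm ?T (?x (?u \<phi>)) (?x (?u \<psi>))"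
        using Suszko_var_interchangeable[OF l x \<theta> Fm, of _ "\<lambda>_. Var x"] vx xT
        unfolding xu distinguished_def by auto
    qed
    moreover have "?u \<phi> \<in> ?U" "?u \<psi> \<in> ?U"
      using \<phi>\<psi> by (auto elim!: subst_terms intro: terms.Var)
    ultimately have "(?u \<phi>, ?u \<psi>) \<in> E"
      by (simp add: E_def)
    hence "eval A (\<lambda>_. a) (?u \<phi>) = eval A (\<lambda>_. a) (?u \<psi>)"
      using ne aF by blast
    thus "eval A (\<lambda>_. a) \<phi> = eval A (\<lambda>_. a) \<psi>"
      by (simp add: eval_subst)
  qed
qed

section \<open>Quotients by the Suszko congruence\<close>

text \<open>The injection \<open>c\<close> makes it possible to form the quotient of a formula algebra inside the
  universe: a class is represented by the image of one of its elements.\<close>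

lemma Suszko_quotient:
  fixes A :: "('u::wellorder, 'a) algebra" and c :: "'a \<Rightarrow> 'b"
  assumes A: "is_algebra (lang l) A" and F: "deductive_filter l A F" and c: "inj_on c (carrier A)"
  obtains D :: "('u, 'b) algebra" and k where "is_algebra (lang l) D" "is_hom (lang l) A D k"
    "k ` carrier A = carrier D"
    "\<And>a b. a \<in> carrier A \<Longrightarrow> b \<in> carrier A \<Longrightarrow> k a = k b \<longleftrightarrow> (a, b) \<in> Suszko_congruence l A F"
proof -
  let ?\<theta> = "Suszko_congruence l A F"
  note \<theta>_iff = Suszko_iff_distinguished[OF A F]
  have refl: "(a, a) \<in> ?\<theta>" if "a \<in> carrier A" for a
    using that by (simp add: \<theta>_iff distinguished_def)
  have sym: "(b, a) \<in> ?\<theta>" if "(a, b) \<in> ?\<theta>" for a b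
    using that unfolding \<theta>_iff distinguished_def by metis
  have trans: "(a, d) \<in> ?\<theta>" if "(a, b) \<in> ?\<theta>" "(b, d) \<in> ?\<theta>" for a b d
    using that unfolding \<theta>_iff distinguished_def by metis
  have fld: "b \<in> carrier A" if "(a, b) \<in> ?\<theta>" for a b
    using that by (simp add: \<theta>_iff)
  have cong: "(interp A f as, interp A f bs) \<in> ?\<theta>"
    if f: "f \<in> syms (lang l)" "length as = arity (lang l) f" "list_all2 (\<lambda>a b. (a, b) \<in> ?\<theta>) as bs" for f as bs
    unfolding Suszko_congruence_def
  proof (rule InterI)
    fix \<eta> assume "\<eta> \<in> {Leibniz_congruence (lang l) A G |G. deductive_filter l A G \<and> F \<subseteq> G}"
    then obtain G where G: "deductive_filter l A G" "F \<subseteq> G" "\<eta> = Leibniz_congruence (lang l) A G"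
      by blast
    have "list_all2 (\<lambda>a b. (a, b) \<in> \<eta>) as bs"
      using f(3) by (rule list_all2_mono) (use G in \<open>auto simp: Suszko_congruence_def\<close>)
    moreover have "congruence (lang l) A \<eta>"
      unfolding G(3) by (rule Leibniz_congruence_greatest(1)[OF A filter_subset[OF G(1)]])
    ultimately show "(interp A f as, interp A f bs) \<in> \<eta>"
      using f(1,2) unfolding congruence_def by simp
  qed
  define k where "k a = c (SOME b. (a, b) \<in> ?\<theta>)" for a
  have some: "(a, SOME b. (a, b) \<in> ?\<theta>) \<in> ?\<theta>" if "a \<in> carrier A" for a
    using refl[OF that] by (rule someI)
  have k_iff: "k a = k b \<longleftrightarrow> (a, b) \<in> ?\<theta>" if "a \<in> carrier A" "b \<in> carrier A" for a b
  proof
    assume "k a = k b"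
    moreover have "(SOME d. (a, d) \<in> ?\<theta>) \<in> carrier A" "(SOME d. (b, d) \<in> ?\<theta>) \<in> carrier A"
      by (rule fld[OF some[OF that(1)]], rule fld[OF some[OF that(2)]])
    ultimately have "(SOME d. (a, d) \<in> ?\<theta>) = (SOME d. (b, d) \<in> ?\<theta>)"
      using c unfolding k_def inj_on_def by blast
    thus "(a, b) \<in> ?\<theta>"
      using trans[OF some[OF that(1)]] sym[OF some[OF that(2)]] by simp
  next
    assume "(a, b) \<in> ?\<theta>"
    hence "(a, d) \<in> ?\<theta> \<longleftrightarrow> (b, d) \<in> ?\<theta>" for d
      using trans sym by blast
    thus "k a = k b"
      by (simp add: k_def)
  qed
  define r where "r = inv_into (carrier A) k"
  have r: "r d \<in> carrier A" "k (r d) = d" if "d \<in> k ` carrier A" for d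
    using that unfolding r_def by (rule inv_into_into, rule f_inv_into_f)
  define D where "D = \<lparr>carrier = k ` carrier A, interp = \<lambda>f ds. k (interp A f (map r ds))\<rparr>"
  have closed: "interp A f as \<in> carrier A"
    if "f \<in> syms (lang l)" "length as = arity (lang l) f" "set as \<subseteq> carrier A" for f as
    using A that by (simp add: is_algebra_def)
  have "carrier A \<noteq> {}"
    using A by (simp add: is_algebra_def)
  moreover have "interp D f ds \<in> carrier D"
    if "f \<in> syms (lang l)" "length ds = arity (lang l) f" "set ds \<subseteq> carrier D" for f ds
  proof -
    have "set (map r ds) \<subseteq> carrier A"
      using that(3) r(1) by (auto simp: D_def)
    thus ?thesis
      using closed[of f "map r ds"] that by (simp add: D_def)
  qed
  ultimately have D: "is_algebra (lang l) D"
    by (simp add: is_algebra_def) (simp add: D_def)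
  have "k (interp A f as) = interp D f (map k as)"
    if f: "f \<in> syms (lang l)" "length as = arity (lang l) f" "set as \<subseteq> carrier A" for f as
  proof -
    have rk: "(a, r (k a)) \<in> ?\<theta>" if "a \<in> carrier A" for a
    proof -
      have "k a \<in> k ` carrier A" using that by simp
      from k_iff[OF that r(1)[OF this]] r(2)[OF this] show ?thesis by simp
    qed
    have "list_all2 (\<lambda>a b. (a, b) \<in> ?\<theta>) as (map r (map k as))"
      using f(3) rk by (simp add: list_all2_conv_all_nth subset_iff)
    hence "(interp A f as, interp A f (map r (map k as))) \<in> ?\<theta>"
      using cong f by blast
    moreover have "interp A f as \<in> carrier A"
      by (rule closed[OF f])
    ultimately have "k (interp A f as) = k (interp A f (map r (map k as)))"
      using k_iff fld by blast
    thus ?thesis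
      by (simp add: D_def)
  qed
  hence "is_hom (lang l) A D k"
    by (simp add: is_hom_def) (simp add: D_def)
  moreover have "k ` carrier A = carrier D"
    by (simp add: D_def)
  ultimately show ?thesis
    using D k_iff by (intro that) simp_all
qed

text \<open>A filter that is a union of classes is the preimage of its image.\<close>

lemma Suszko_quotient_filter:
  assumes l: "is_logic l" and A: "is_algebra (lang l) A" and D: "is_algebra (lang l) D"
    and k: "is_hom (lang l) A D k" "k ` carrier A = carrier D"
    and k_iff: "\<And>a b. a \<in> carrier A \<Longrightarrow> b \<in> carrier A \<Longrightarrow> k a = k b \<longleftrightarrow> (a, b) \<in> \<theta>"
    and G: "deductive_filter l A G" and sat: "\<And>a b. (a, b) \<in> \<theta> \<Longrightarrow> a \<in> G \<Longrightarrow> b \<in> G"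
  shows "deductive_filter l D (k ` G)" and "\<And>a. a \<in> carrier A \<Longrightarrow> k a \<in> k ` G \<longleftrightarrow> a \<in> G"
proof -
  have *: "k a \<in> k ` G \<longleftrightarrow> a \<in> G" if "a \<in> carrier A" for a
    using that k_iff[OF _ that] sat filter_subset[OF G] by (metis imageE imageI subsetD)
  hence "{a \<in> carrier A. k a \<in> k ` G} = G"
    using filter_subset[OF G] by blast
  thus "deductive_filter l D (k ` G)"
    using G filter_subset[OF G] k(2) by (intro filter_of_vimage[OF l A D k]) auto
  show "k a \<in> k ` G \<longleftrightarrow> a \<in> G" if "a \<in> carrier A" for a
    by (rule *[OF that])
qed

text \<open>The Suszko congruence of \<open>F\<close> is compatible with all filters above \<open>F\<close>. Hence these filters,
  which separate the classes, descend to the quotient.\<close>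

lemma suszko_reduced_quotient:
  assumes l: "is_logic l" and A: "is_algebra (lang l) A" and F: "deductive_filter l A F"
    and D: "is_algebra (lang l) D" and k: "is_hom (lang l) A D k" "k ` carrier A = carrier D"
    and k_iff: "\<And>a b. a \<in> carrier A \<Longrightarrow> b \<in> carrier A \<Longrightarrow>
      k a = k b \<longleftrightarrow> (a, b) \<in> Suszko_congruence l A F"
  shows "suszko_reduced l D (k ` F)"
proof -
  note \<theta>_iff = Suszko_iff_distinguished[OF A F]
  note sat = Suszko_compatible[OF A F]
  have quot: "deductive_filter l D (k ` G)" "a \<in> carrier A \<Longrightarrow> k a \<in> k ` G \<longleftrightarrow> a \<in> G"
    if "deductive_filter l A G" "F \<subseteq> G" for G a
    using Suszko_quotient_filter[OF l A D k, of "Suszko_congruence l A F" G] k_iff that sat[OF that]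
    by blast+
  have "distinguished l D (k ` F) (k a) (k b)"
    if ab: "a \<in> carrier A" "b \<in> carrier A" "k a \<noteq> k b" for a b
  proof -
    have "distinguished l A F a b"
      using ab k_iff[OF ab(1,2)] by (simp add: \<theta>_iff)
    then obtain G p where G: "deductive_filter l A G" "F \<subseteq> G" and p: "p \<in> polys (lang l) A"
      and ne: "(peval A a p \<in> G) \<noteq> (peval A b p \<in> G)"
      unfolding distinguished_def by blast
    obtain q where q: "q \<in> polys (lang l) D"
      "\<And>a. a \<in> carrier A \<Longrightarrow> peval D (k a) q = k (peval A a p)"
      using poly_push[OF k(1) A p] by blast
    have "(peval D (k a) q \<in> k ` G) \<noteq> (peval D (k b) q \<in> k ` G)"
      using ne q(2) ab peval_closed[OF A p] quot(2)[OF G] by simp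
    moreover have "deductive_filter l D (k ` G)"
      by (rule quot(1)[OF G])
    ultimately show ?thesis
      using q(1) G(2) unfolding distinguished_def by blast
  qed
  moreover have "deductive_filter l D (k ` F)"
    by (rule quot(1)[OF F order_refl])
  ultimately show ?thesis
    using D unfolding suszko_reduced_def k(2)[symmetric] by blast
qed


section \<open>Cardinality of sets of terms\<close>

text \<open>Terms and lists over an infinite set \<open>M\<close> are coded in \<open>M\<close> by iterating an injection
  \<open>e\<close> of \<open>M \<times> M\<close> into \<open>M\<close>; the elements \<open>s\<close> and \<open>t\<close> serve as tags.\<close>

primrec code_list :: "('a \<times> 'a \<Rightarrow> 'a) \<Rightarrow> 'a \<Rightarrow> 'a \<Rightarrow> 'a list \<Rightarrow> 'a" where
  "code_list e s t [] = e (s, s)"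
| "code_list e s t (x # xs) = e (t, e (x, code_list e s t xs))"

primrec code_tm :: "('a \<times> 'a \<Rightarrow> 'a) \<Rightarrow> 'a \<Rightarrow> 'a \<Rightarrow> ('a, 'a) tm \<Rightarrow> 'a" where
  "code_tm e s t (Var x) = e (s, x)"
| "code_tm e s t (Fun f ts) = e (t, e (f, code_list e s t (map (code_tm e s t) ts)))"

context
  fixes M :: "'a set" and e s t
  assumes e: "inj_on e (M \<times> M)" "e ` (M \<times> M) \<subseteq> M" and st: "s \<in> M" "t \<in> M" "s \<noteq> t"
begin

lemma code_pair [simp]:
  "x \<in> M \<Longrightarrow> y \<in> M \<Longrightarrow> e (x, y) \<in> M"
  "x \<in> M \<Longrightarrow> y \<in> M \<Longrightarrow> x' \<in> M \<Longrightarrow> y' \<in> M \<Longrightarrow> e (x, y) = e (x', y') \<longleftrightarrow> x = x' \<and> y = y'"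
  using e by (auto simp: inj_on_def)

lemma code_list_in: "set xs \<subseteq> M \<Longrightarrow> code_list e s t xs \<in> M"
  by (induction xs) (auto simp: st)

lemma code_list_inj:
  "set xs \<subseteq> M \<Longrightarrow> set ys \<subseteq> M \<Longrightarrow> code_list e s t xs = code_list e s t ys \<Longrightarrow> xs = ys"
proof (induction xs arbitrary: ys)
  case Nil
  show ?case
  proof (cases ys)
    case (Cons y zs)
    hence "y \<in> M" "code_list e s t zs \<in> M"
      using Nil.prems(2) by (simp_all add: code_list_in)
    thus ?thesis
      using Nil.prems(3) Cons st by simp
  qed simp
next
  case (Cons x xs)
  have xs: "x \<in> M" "code_list e s t xs \<in> M"
    using Cons.prems(1) by (simp_all add: code_list_in)
  show ?case
  proof (cases ys)
    case Nil
    thus ?thesis using Cons.prems(3) xs st by simp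
  next
    case ys: (Cons y zs)
    have "y \<in> M" "code_list e s t zs \<in> M"
      using Cons.prems(2) ys by (simp_all add: code_list_in)
    thus ?thesis
      using Cons xs st ys by simp
  qed
qed

lemma code_tm_in:
  assumes "syms L \<subseteq> M" "X \<subseteq> M"
  shows "u \<in> terms L X \<Longrightarrow> code_tm e s t u \<in> M"
proof (induction rule: terms.induct)
  case (Fun f ts)
  hence "code_list e s t (map (code_tm e s t) ts) \<in> M"
    by (intro code_list_in) auto
  thus ?case using Fun(1) assms(1) st by auto
qed (use assms(2) st in auto)

lemma code_tm_inj:
  assumes LX: "syms L \<subseteq> M" "X \<subseteq> M"
  shows "u \<in> terms L X \<Longrightarrow> u' \<in> terms L X \<Longrightarrow> code_tm e s t u = code_tm e s t u' \<Longrightarrow> u = u'"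
proof (induction arbitrary: u' rule: terms.induct)
  case (Var x)
  from Var.prems(1) show ?case
  proof cases
    case Fun': (Fun g us)
    have "code_list e s t (map (code_tm e s t) us) \<in> M"
      using Fun'(4) code_tm_in[OF LX] by (intro code_list_in) auto
    moreover have "x \<in> M" "g \<in> M"
      using Var.hyps Fun'(2) LX by auto
    ultimately show ?thesis using Var.prems(2) Fun'(1) st by simp
  next
    case (Var y)
    moreover have "x \<in> M" "y \<in> M"
      using \<open>x \<in> X\<close> Var LX by auto
    ultimately show ?thesis using Var.prems(2) st by simp
  qed
next
  case (Fun f ts)
  have ts: "set (map (code_tm e s t) ts) \<subseteq> M"
    using Fun.hyps code_tm_in[OF LX] by auto
  from Fun.prems(1) show ?case
  proof cases
    case (Var y)
    moreover have "y \<in> M" "f \<in> M"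
      using Var Fun.hyps(1) LX by auto
    ultimately show ?thesis using Fun.prems(2) st code_list_in[OF ts] by simp
  next
    case Fun': (Fun g us)
    have us: "set (map (code_tm e s t) us) \<subseteq> M"
      using Fun'(4) code_tm_in[OF LX] by auto
    have fg: "f \<in> M" "g \<in> M"
      using Fun.hyps(1) Fun'(2) LX by auto
    from Fun.prems(2) have fg': "f = g"
      and "code_list e s t (map (code_tm e s t) ts) = code_list e s t (map (code_tm e s t) us)"
      using Fun' fg st code_list_in[OF ts] code_list_in[OF us] by auto
    hence eq: "map (code_tm e s t) ts = map (code_tm e s t) us"
      using code_list_inj[OF ts us] by blast
    hence len: "length ts = length us"
      using map_eq_imp_length_eq by blast
    have "ts = us"
    proof (rule nth_equalityI[OF len])
      fix i assume i: "i < length ts"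
      have "code_tm e s t (ts ! i) = code_tm e s t (us ! i)"
        using eq i len by (metis nth_map)
      thus "ts ! i = us ! i"
        using i len Fun'(4) by (intro Fun.IH) auto
    qed
    thus ?thesis using Fun'(1) fg' by simp
  qed
qed

end

lemma
  fixes M :: "'a set"
  assumes "infinite M"
  shows card_of_lists: "|lists M| \<le>o |M|"
    and card_of_terms: "syms L \<subseteq> M \<Longrightarrow> X \<subseteq> M \<Longrightarrow> |terms L X| \<le>o |M|"
proof -
  have "|M \<times> M| \<le>o |M|"
    using card_of_Times_same_infinite[OF assms] ordIso_imp_ordLeq by blast
  then obtain e where e: "inj_on e (M \<times> M)" "e ` (M \<times> M) \<subseteq> M"
    unfolding card_of_ordLeq[symmetric] by blast
  obtain s where s: "s \<in> M"
    using assms by fastforce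
  obtain t where t: "t \<in> M" "s \<noteq> t"
    using assms by (metis finite.emptyI finite_insert infinite_super insertCI subsetI)
  show "|lists M| \<le>o |M|"
    unfolding card_of_ordLeq[symmetric]
    using code_list_in[OF e s t] code_list_inj[OF e s t]
    by (intro exI[of _ "code_list e s t"]) (auto simp: inj_on_def lists_eq_set)
  show "|terms L X| \<le>o |M|" if "syms L \<subseteq> M" "X \<subseteq> M"
    unfolding card_of_ordLeq[symmetric]
    using code_tm_in[OF e s t that] code_tm_inj[OF e s t that]
    by (intro exI[of _ "code_tm e s t"]) (auto simp: inj_on_def)
qed


section \<open>Two filters on one reduced algebra\<close>

lemma small_mono: "|A| \<le>o |B| \<Longrightarrow> small B \<Longrightarrow> small (A :: 'u set)" for B :: "'u set"
  unfolding small_def by (rule ordLeq_ordLess_trans)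

lemma infinite_universe:
  assumes "inaccessible_universe TYPE('u::wellorder)"
  shows "infinite (UNIV :: 'u set)"
proof -
  have "natLeq \<le>o |UNIV :: 'u set|"
    using assms unfolding inaccessible_universe_def by (elim conjE) (rule ordLess_imp_ordLeq)
  thus ?thesis
    using infinite_iff_natLeq_ordLeq[of "UNIV :: 'u set"] by simp
qed

lemma small_Un:
  "inaccessible_universe TYPE('u::wellorder) \<Longrightarrow> small A \<Longrightarrow> small B \<Longrightarrow> small (A \<union> B :: 'u set)"
  unfolding small_def by (rule card_of_Un_ordLess_infinite[OF infinite_universe])

lemma small_lessThan: "inaccessible_universe TYPE('u::wellorder) \<Longrightarrow> small {..<\<alpha> :: 'u}"
  by (simp add: inaccessible_universe_def)

text \<open>The only filter above the total one is the total one, and it distinguishes no points.\<close>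

lemma reduced_filter_proper:
  assumes "suszko_reduced l A F" and "a \<in> carrier A" "b \<in> carrier A" "a \<noteq> b"
  shows "F \<noteq> carrier A"
proof
  assume F: "F = carrier A"
  have A: "is_algebra (lang l) A"
    using assms(1) by (simp add: suszko_reduced_def)
  obtain G p where G: "deductive_filter l A G" "F \<subseteq> G" and p: "p \<in> polys (lang l) A"
    and ne: "(peval A a p \<in> G) \<noteq> (peval A b p \<in> G)"
    using assms unfolding suszko_reduced_def distinguished_def by blast
  have "G = carrier A"
    using filter_subset[OF G(1)] G(2) F by blast
  thus False
    using ne peval_closed[OF A p] assms(2,3) by simp
qed

text \<open>Let \<open>h\<close> send all variables to a point \<open>a \<notin> F\<close> that satisfies the equations of the Suszko
  congruence of the theory of \<open>x\<close>. Then \<open>h\<close> identifies congruent formulas, so that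
  \<open>h\<^sup>-\<^sup>1[F]\<close> is a union of classes, like the theory of \<open>x\<close>. Hence this theory and its intersection
  with \<open>h\<^sup>-\<^sup>1[F]\<close> both survive in the quotient of the formula algebra by that congruence. Only the larger one contains \<open>x\<close>. The smaller filter is also reduced, since
  the Suszko congruence is monotone in the filter.\<close>

lemma two_reduced_filters:
  fixes l :: "'u::wellorder logic"
  assumes U: "inaccessible_universe TYPE('u)" and l: "is_logic l" "has_theorems l"
    and nte: "\<not> truth_equational l"
  obtains D :: "('u, 'u) algebra" and G\<^sub>0 G\<^sub>1 where "small (carrier D)"
    "suszko_reduced l D G\<^sub>0" "suszko_reduced l D G\<^sub>1" "G\<^sub>0 \<subset> G\<^sub>1" "G\<^sub>0 \<noteq> {}" "G\<^sub>1 \<noteq> carrier D"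
proof -
  let ?Fm = "formula_algebra l"
  obtain x where x: "x \<in> {..<nvars l}"
    using nvars_nonempty[OF l(1)] by blast
  let ?T = "consequences_of_var l x"
  let ?\<theta> = "Suszko_congruence l ?Fm ?T"
  have Fm: "is_algebra (lang l) ?Fm"
    by (rule is_algebra_Fm[OF nvars_nonempty[OF l(1)]])
  have vx: "Var x \<in> terms (lang l) {..<nvars l}"
    using x by (rule terms.Var)
  have T: "deductive_filter l ?Fm ?T"
    using vx by (intro filter_theory[OF l(1)]) auto
  have xT: "Var x \<in> ?T"
    using entails_refl[OF l(1), of "{Var x}"] vx by simp
  obtain A F a where M: "(A, F) \<in> Mod_Suszko l" and a: "a \<in> carrier A" "a \<notin> F"
    and eqs: "\<And>\<phi> \<psi>. (\<phi>, \<psi>) \<in> ?\<theta> \<Longrightarrow> eval A (\<lambda>_. a) \<phi> = eval A (\<lambda>_. a) \<psi>"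
    using not_truth_equationalE[OF l(1) nte x] by blast
  have A: "is_algebra (lang l) A" and F: "deductive_filter l A F"
    using M by (auto simp: Mod_Suszko_iff suszko_reduced_def)
  have h: "is_hom (lang l) ?Fm A (eval A (\<lambda>_. a))"
    using a(1) by (intro is_hom_eval[OF A])
  define T\<^sub>0 where "T\<^sub>0 = ?T \<inter> {\<phi> \<in> carrier ?Fm. eval A (\<lambda>_. a) \<phi> \<in> F}"
  have T\<^sub>0: "deductive_filter l ?Fm T\<^sub>0"
    unfolding T\<^sub>0_def by (intro filter_Int T filter_vimage[OF l(1) h F])
  have card: "|carrier ?Fm| \<le>o |syms (lang l) \<union> {..<nvars l}|"
    unfolding carrier_Fm using nvars_infinite[OF l(1)] by (intro card_of_terms) auto
  have small: "small (syms (lang l) \<union> {..<nvars l})"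
    using l(1) by (intro small_Un[OF U] small_lessThan[OF U]) (simp add: is_logic_def is_language_def)
  have "|carrier ?Fm| \<le>o |UNIV :: 'u set|"
    using ordLeq_ordLess_trans[OF card small[unfolded small_def]] by (rule ordLess_imp_ordLeq)
  then obtain c :: "('u, 'u) tm \<Rightarrow> 'u" where c: "inj_on c (carrier ?Fm)"
    unfolding card_of_ordLeq[symmetric] by blast
  obtain D :: "('u, 'u) algebra" and k where D: "is_algebra (lang l) D"
    and k: "is_hom (lang l) ?Fm D k" "k ` carrier ?Fm = carrier D"
    and k_iff: "\<And>\<phi> \<psi>. \<phi> \<in> carrier ?Fm \<Longrightarrow> \<psi> \<in> carrier ?Fm \<Longrightarrow> k \<phi> = k \<psi> \<longleftrightarrow> (\<phi>, \<psi>) \<in> ?\<theta>"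
    using Suszko_quotient[OF Fm T c] by blast
  have red: "suszko_reduced l D (k ` ?T)"
    by (rule suszko_reduced_quotient[OF l(1) Fm T D k k_iff])
  note sat = Suszko_compatible[OF Fm T T order_refl]
  have sat\<^sub>0: "\<psi> \<in> T\<^sub>0" if "(\<phi>, \<psi>) \<in> ?\<theta>" "\<phi> \<in> T\<^sub>0" for \<phi> \<psi>
  proof -
    have "\<psi> \<in> carrier ?Fm"
      using that(1) unfolding Suszko_iff_distinguished[OF Fm T] by blast
    moreover have "\<psi> \<in> ?T"
      using sat[OF that(1)] that(2) unfolding T\<^sub>0_def by blast
    moreover have "eval A (\<lambda>_. a) \<psi> \<in> F"
      using eqs[OF that(1)] that(2) unfolding T\<^sub>0_def by simp
    ultimately show ?thesis
      unfolding T\<^sub>0_def by blast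
  qed
  have D\<^sub>0: "deductive_filter l D (k ` T\<^sub>0)"
    and kT\<^sub>0: "\<And>\<phi>. \<phi> \<in> carrier ?Fm \<Longrightarrow> k \<phi> \<in> k ` T\<^sub>0 \<longleftrightarrow> \<phi> \<in> T\<^sub>0"
    using Suszko_quotient_filter[OF l(1) Fm D k, of ?\<theta> T\<^sub>0] k_iff T\<^sub>0 sat\<^sub>0 by blast+
  have sub: "k ` T\<^sub>0 \<subset> k ` ?T"
  proof
    show "k ` T\<^sub>0 \<subseteq> k ` ?T"
      unfolding T\<^sub>0_def by blast
    have "k (Var x) \<notin> k ` T\<^sub>0"
      using kT\<^sub>0[of "Var x"] vx a(2) by (simp add: T\<^sub>0_def)
    thus "k ` T\<^sub>0 \<noteq> k ` ?T"
      using xT by blast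
  qed
  have ne: "k ` T\<^sub>0 \<noteq> {}"
    by (rule filter_nonempty[OF l D D\<^sub>0])
  obtain a b where "a \<in> k ` ?T" "b \<in> k ` ?T" "a \<noteq> b"
    using sub ne by blast
  hence proper: "k ` ?T \<noteq> carrier D"
    using reduced_filter_proper[OF red] filter_subset[of l D "k ` ?T"] red
    unfolding suszko_reduced_def by blast
  have "small (carrier D)"
    unfolding k(2)[symmetric] by (rule small_mono[OF ordLeq_transitive[OF card_of_image card] small])
  thus ?thesis
    using that suszko_reduced_mono[OF red D\<^sub>0] red sub ne proper by blast
qed


section \<open>Powers\<close>

text \<open>The power of \<open>D\<close> with index set \<open>J\<close>, realised on a set \<open>S\<close> whose elements are given their
  coordinates by a bijection \<open>\<chi>\<close> from \<open>S\<close> onto the set of all families.\<close>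

definition power_algebra :: "('f, 'a) algebra \<Rightarrow> 'j set \<Rightarrow> 's set \<Rightarrow> ('s \<Rightarrow> 'j \<Rightarrow> 'a) \<Rightarrow> ('f, 's) algebra" where
  "power_algebra D J S \<chi> = \<lparr>carrier = S,
     interp = \<lambda>f as. inv_into S \<chi> (\<lambda>j\<in>J. interp D f (map (\<lambda>s. \<chi> s j) as))\<rparr>"

lemma carrier_power [simp]: "carrier (power_algebra D J S \<chi>) = S"
  by (simp add: power_algebra_def)

context
  fixes D :: "('f, 'a) algebra" and J :: "'j set" and S :: "'s set" and \<chi> L
  assumes D: "is_algebra L D" and \<chi>: "bij_betw \<chi> S (J \<rightarrow>\<^sub>E carrier D)"
begin

lemma coordinate_in: "s \<in> S \<Longrightarrow> j \<in> J \<Longrightarrow> \<chi> s j \<in> carrier D"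
  using \<chi> by (auto simp: bij_betw_def dest: PiE_mem)

lemma interp_power:
  assumes "f \<in> syms L" "length as = arity L f" "set as \<subseteq> S"
  shows "interp (power_algebra D J S \<chi>) f as \<in> S"
    and "j \<in> J \<Longrightarrow> \<chi> (interp (power_algebra D J S \<chi>) f as) j = interp D f (map (\<lambda>s. \<chi> s j) as)"
proof -
  let ?r = "\<lambda>j\<in>J. interp D f (map (\<lambda>s. \<chi> s j) as)"
  have "interp D f (map (\<lambda>s. \<chi> s j) as) \<in> carrier D" if "j \<in> J" for j
  proof -
    have "set (map (\<lambda>s. \<chi> s j) as) \<subseteq> carrier D"
      using assms(3) coordinate_in that by auto
    thus ?thesis
      using D assms(1,2) by (simp add: is_algebra_def)
  qed
  hence r: "?r \<in> \<chi> ` S"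
    using \<chi> by (simp add: bij_betw_def)
  show "interp (power_algebra D J S \<chi>) f as \<in> S"
    unfolding power_algebra_def using inv_into_into[OF r] by simp
  show "j \<in> J \<Longrightarrow> \<chi> (interp (power_algebra D J S \<chi>) f as) j = interp D f (map (\<lambda>s. \<chi> s j) as)"
    unfolding power_algebra_def using f_inv_into_f[OF r] by simp
qed

lemma is_algebra_power: "is_algebra L (power_algebra D J S \<chi>)"
proof -
  have "J \<rightarrow>\<^sub>E carrier D \<noteq> {}"
    using D by (auto simp: is_algebra_def PiE_eq_empty_iff)
  hence "S \<noteq> {}"
    using \<chi> by (auto simp: bij_betw_def)
  thus ?thesis
    unfolding is_algebra_def using interp_power(1) by simp
qed

lemma is_hom_coordinate: "j \<in> J \<Longrightarrow> is_hom L (power_algebra D J S \<chi>) D (\<lambda>s. \<chi> s j)"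
  unfolding is_hom_def using interp_power(2) coordinate_in by auto

lemma coordinate_surj:
  assumes "j \<in> J"
  shows "(\<lambda>s. \<chi> s j) ` S = carrier D"
proof
  show "carrier D \<subseteq> (\<lambda>s. \<chi> s j) ` S"
  proof
    fix d assume "d \<in> carrier D"
    hence "(\<lambda>_\<in>J. d) \<in> \<chi> ` S"
      using \<chi> by (simp add: bij_betw_def)
    then obtain s where "s \<in> S" "\<chi> s = (\<lambda>_\<in>J. d)" by auto
    thus "d \<in> (\<lambda>s. \<chi> s j) ` S"
      using assms by (intro image_eqI[of _ _ s]) auto
  qed
qed (use coordinate_in assms in auto)

end

text \<open>The filter may vary from coordinate to coordinate, which gives control over the cardinality
  of the product filter.\<close>

lemma suszko_reduced_power:
  fixes D :: "('u::wellorder, 'a) algebra" and \<chi> :: "'s \<Rightarrow> 'j \<Rightarrow> 'a"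
  assumes l: "is_logic l" and \<chi>: "bij_betw \<chi> S (J \<rightarrow>\<^sub>E carrier D)" and D: "is_algebra (lang l) D"
    and G: "\<And>j. j \<in> J \<Longrightarrow> suszko_reduced l D (G j)"
  shows "suszko_reduced l (power_algebra D J S \<chi>) {s \<in> S. \<forall>j\<in>J. \<chi> s j \<in> G j}"
proof (rule suszko_reducedI[OF l])
  let ?P = "power_algebra D J S \<chi>" and ?F = "{s \<in> S. \<forall>j\<in>J. \<chi> s j \<in> G j}"
  show P: "is_algebra (lang l) ?P"
    by (rule is_algebra_power[OF D \<chi>])
  show "deductive_filter l ?P ?F"
  proof (rule filterI[OF l])
    fix \<Gamma> \<phi> v
    assume e: "entails l \<Gamma> \<phi>" and v: "v ` {..<nvars l} \<subseteq> carrier ?P" and sub: "eval ?P v ` \<Gamma> \<subseteq> ?F"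
    have h: "\<chi> (eval ?P v \<psi>) j = eval D (\<lambda>x. \<chi> (v x) j) \<psi>"
      if "j \<in> J" "\<psi> \<in> terms (lang l) {..<nvars l}" for \<psi> j
      using hom_eval[OF is_hom_coordinate[OF D \<chi> that(1)] P that(2)] v by auto
    have "\<chi> (eval ?P v \<phi>) j \<in> G j" if j: "j \<in> J" for j
    proof -
      have "eval D (\<lambda>x. \<chi> (v x) j) \<phi> \<in> G j"
      proof (rule filter_eval[OF D _ e])
        show "deductive_filter l D (G j)"
          using G[OF j] by (simp add: suszko_reduced_def)
        show "(\<lambda>x. \<chi> (v x) j) ` {..<nvars l} \<subseteq> carrier D"
          using v coordinate_in[OF D \<chi> _ j] by auto
        show "eval D (\<lambda>x. \<chi> (v x) j) ` \<Gamma> \<subseteq> G j"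
        proof
          fix y assume "y \<in> eval D (\<lambda>x. \<chi> (v x) j) ` \<Gamma>"
          then obtain \<gamma> where \<gamma>: "\<gamma> \<in> \<Gamma>" "y = eval D (\<lambda>x. \<chi> (v x) j) \<gamma>" by blast
          hence "y = \<chi> (eval ?P v \<gamma>) j"
            using h[OF j] entails_formulas[OF l e] by (metis subsetD)
          thus "y \<in> G j"
            using sub \<gamma>(1) j by auto
        qed
      qed
      thus ?thesis
        using h[OF j] entails_formulas[OF l e] by simp
    qed
    moreover have "eval ?P v \<phi> \<in> S"
      using eval_closed[OF P conjunct2[OF entails_formulas[OF l e]], of v] v by auto
    ultimately show "eval ?P v \<phi> \<in> ?F"
      by simp
  qed auto
  fix a b assume ab: "a \<in> carrier ?P" "b \<in> carrier ?P" "a \<noteq> b"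
  hence "\<chi> a \<noteq> \<chi> b" "\<chi> a \<in> J \<rightarrow>\<^sub>E carrier D" "\<chi> b \<in> J \<rightarrow>\<^sub>E carrier D"
    using \<chi> by (auto simp: bij_betw_def inj_on_def)
  then obtain j where j: "j \<in> J" "\<chi> a j \<noteq> \<chi> b j"
    by (meson PiE_ext)
  have "(\<lambda>s. \<chi> s j) ` ?F \<subseteq> G j"
    using j(1) by auto
  thus "\<exists>B G h. suszko_reduced l (B :: ('u, 'a) algebra) G \<and> is_hom (lang l) ?P B h \<and>
      h ` carrier ?P = carrier B \<and> h ` ?F \<subseteq> G \<and> h a \<noteq> h b"
    using G[OF j(1)] is_hom_coordinate[OF D \<chi> j(1)] coordinate_surj[OF D \<chi> j(1)] j(2)
    by (intro exI[of _ D] exI[of _ "G j"] exI[of _ "\<lambda>s. \<chi> s j"]) simp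
qed


text \<open>All the parts into which the two filters below divide a power have the cardinality of
  \<open>Pow J\<close>: one coordinate selects the part, the others provide two values each.\<close>

lemma Pow_le_PiE:
  assumes "infinite J" "j\<^sub>0 \<in> J" "w \<in> W" "a \<in> V" "b \<in> V" "a \<noteq> b"
  shows "|Pow J| \<le>o |PiE J (\<lambda>j. if j = j\<^sub>0 then W else V)|"
proof -
  obtain h where h: "bij_betw h J (J - {j\<^sub>0})"
    using infinite_imp_bij_betw[OF assms(1)] by blast
  define g where "g X = (\<lambda>j\<in>J. if j = j\<^sub>0 then w else if j \<in> h ` X then a else b)" for X
  have "X \<subseteq> Y" if "X \<subseteq> J" "Y \<subseteq> J" "g X = g Y" for X Y
  proof
    fix i assume i: "i \<in> X"
    hence hi: "h i \<in> J" "h i \<noteq> j\<^sub>0"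
      using that(1) h by (auto simp: bij_betw_def)
    have "g X (h i) = a"
      using i hi by (simp add: g_def)
    hence "h i \<in> h ` Y"
      using hi assms(6) unfolding that(3) by (simp add: g_def split: if_splits)
    thus "i \<in> Y"
      using h i that(1,2) by (auto simp: bij_betw_def inj_on_def)
  qed
  hence "inj_on g (Pow J)"
    unfolding inj_on_def by (metis PowD subset_antisym)
  moreover have "g ` Pow J \<subseteq> PiE J (\<lambda>j. if j = j\<^sub>0 then W else V)"
    using assms by (auto simp: g_def)
  ultimately show ?thesis
    unfolding card_of_ordLeq[symmetric] by blast
qed

lemma PiE_le_Pow:
  assumes "infinite J" and "|C| \<le>o |J|"
  shows "|J \<rightarrow>\<^sub>E C| \<le>o |Pow J|"
proof -
  have "|J \<times> C| \<le>o |J \<times> J|"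
    by (rule card_of_Times_mono2[OF assms(2)])
  hence "|J \<times> C| \<le>o |J|"
    using card_of_Times_same_infinite[OF assms(1)] by (rule ordLeq_ordIso_trans)
  then obtain e where e: "inj_on e (J \<times> C)" "e ` (J \<times> C) \<subseteq> J"
    unfolding card_of_ordLeq[symmetric] by blast
  define g where "g f = e ` {(j, f j) |j. j \<in> J}" for f
  have "f = f'" if f: "f \<in> J \<rightarrow>\<^sub>E C" "f' \<in> J \<rightarrow>\<^sub>E C" "g f = g f'" for f f'
  proof -
    have "{(j, f j) |j. j \<in> J} \<subseteq> J \<times> C" "{(j, f' j) |j. j \<in> J} \<subseteq> J \<times> C"
      using f(1,2) by auto
    hence eq: "{(j, f j) |j. j \<in> J} = {(j, f' j) |j. j \<in> J}"
      using f(3) unfolding g_def by (subst (asm) inj_on_image_eq_iff[OF e(1)])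
    have "f j = f' j" if "j \<in> J" for j
    proof -
      have "(j, f j) \<in> {(j, f' j) |j. j \<in> J}"
        unfolding eq[symmetric] using that by blast
      thus ?thesis by blast
    qed
    thus ?thesis
      by (rule PiE_ext[OF f(1,2)])
  qed
  hence "inj_on g (J \<rightarrow>\<^sub>E C)"
    by (simp add: inj_on_def)
  moreover have "g ` (J \<rightarrow>\<^sub>E C) \<subseteq> Pow J"
    using e(2) by (auto simp: g_def)
  ultimately show ?thesis
    unfolding card_of_ordLeq[symmetric] by blast
qed

text \<open>Up to isomorphism, a reduced algebra with two filters can be taken to have any prescribed
  carrier and filters, as long as the three parts of the carrier have the same, sufficiently
  large, cardinality. This is how algebras of unrelated logics are brought together. The smaller
  filter is \<open>G\<^sub>0\<close> in one coordinate and \<open>G\<^sub>1\<close> in all others, and the larger one is \<open>G\<^sub>1\<close> in all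
  coordinates: \<open>G\<^sub>0\<close> might be a singleton, but \<open>G\<^sub>1\<close> has at least two elements.\<close>

lemma suszko_reduced_on_pieces:
  fixes D :: "('u::wellorder, 'a) algebra" and P\<^sub>0 P\<^sub>1 P\<^sub>2 :: "'s set" and J :: "'j set"
  assumes l: "is_logic l" and G\<^sub>0: "suszko_reduced l D G\<^sub>0" and G\<^sub>1: "suszko_reduced l D G\<^sub>1"
    and sub: "G\<^sub>0 \<subset> G\<^sub>1" and ne: "G\<^sub>0 \<noteq> {}" "G\<^sub>1 \<noteq> carrier D"
    and J: "infinite J" "|carrier D| \<le>o |J|"
    and P: "|P\<^sub>0| =o |Pow J|" "|P\<^sub>1| =o |Pow J|" "|P\<^sub>2| =o |Pow J|"
      "P\<^sub>0 \<inter> P\<^sub>1 = {}" "P\<^sub>0 \<inter> P\<^sub>2 = {}" "P\<^sub>1 \<inter> P\<^sub>2 = {}"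
  obtains A :: "('u, 's) algebra" where "carrier A = P\<^sub>0 \<union> P\<^sub>1 \<union> P\<^sub>2"
    "suszko_reduced l A P\<^sub>0" "suszko_reduced l A (P\<^sub>0 \<union> P\<^sub>1)"
proof -
  have D: "is_algebra (lang l) D"
    using G\<^sub>0 by (simp add: suszko_reduced_def)
  have G\<^sub>1D: "G\<^sub>1 \<subseteq> carrier D"
    using G\<^sub>1 filter_subset unfolding suszko_reduced_def by blast
  obtain j\<^sub>0 where j\<^sub>0: "j\<^sub>0 \<in> J"
    using J(1) by fastforce
  obtain g\<^sub>0 where g\<^sub>0: "g\<^sub>0 \<in> G\<^sub>0"
    using ne(1) by blast
  obtain g\<^sub>1 where g\<^sub>1: "g\<^sub>1 \<in> G\<^sub>1 - G\<^sub>0"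
    using sub by blast
  obtain d where d: "d \<in> carrier D - G\<^sub>1"
    using ne(2) G\<^sub>1D by blast
  define R where "R W V = PiE J (\<lambda>j. if j = j\<^sub>0 then W else V)" for W V :: "'a set"
  have card: "|X| =o |Pow J|" if X: "R W V \<subseteq> X" "X \<subseteq> J \<rightarrow>\<^sub>E carrier D" "w \<in> W" "G\<^sub>1 \<subseteq> V" for X W V w
  proof -
    have "g\<^sub>0 \<in> V" "g\<^sub>1 \<in> V" "g\<^sub>0 \<noteq> g\<^sub>1"
      using g\<^sub>0 g\<^sub>1 sub X(4) by auto
    hence "|Pow J| \<le>o |R W V|"
      unfolding R_def by (rule Pow_le_PiE[OF J(1) j\<^sub>0 X(3)])
    also have "|R W V| \<le>o |X|"
      by (rule card_of_mono1[OF X(1)])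
    finally have "|Pow J| \<le>o |X|" .
    moreover have "|X| \<le>o |Pow J|"
      using card_of_mono1[OF X(2)] PiE_le_Pow[OF J] by (rule ordLeq_transitive)
    ultimately show ?thesis
      by (simp add: ordIso_iff_ordLeq)
  qed
  have bij: "\<exists>b. bij_betw b P X" if "|P| =o |Pow J|" "|X| =o |Pow J|" for P :: "'s set" and X :: "('j \<Rightarrow> 'a) set"
    using ordIso_transitive[OF that(1) ordIso_symmetric[OF that(2)]] card_of_ordIso by blast
  define R\<^sub>0 R\<^sub>1 R\<^sub>2 where "R\<^sub>0 = R G\<^sub>0 G\<^sub>1" and "R\<^sub>1 = R G\<^sub>1 G\<^sub>1 - R G\<^sub>0 G\<^sub>1"
    and "R\<^sub>2 = (J \<rightarrow>\<^sub>E carrier D) - R G\<^sub>1 G\<^sub>1"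
  have R\<^sub>0\<^sub>1: "R G\<^sub>0 G\<^sub>1 \<subseteq> R G\<^sub>1 G\<^sub>1" and R\<^sub>1D: "R G\<^sub>1 G\<^sub>1 \<subseteq> J \<rightarrow>\<^sub>E carrier D"
    unfolding R_def using sub G\<^sub>1D by (auto intro!: PiE_mono split: if_splits)
  have mem: "f j\<^sub>0 \<in> W" if "f \<in> R W V" for f W V
    using that j\<^sub>0 unfolding R_def by (auto dest: PiE_mem)
  have "R (G\<^sub>1 - G\<^sub>0) G\<^sub>1 \<subseteq> R\<^sub>1"
  proof -
    have "R (G\<^sub>1 - G\<^sub>0) G\<^sub>1 \<subseteq> R G\<^sub>1 G\<^sub>1"
      unfolding R_def using G\<^sub>1D by (auto intro!: PiE_mono split: if_splits)
    thus ?thesis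
      using mem unfolding R\<^sub>1_def by blast
  qed
  moreover have "R (carrier D - G\<^sub>1) (carrier D) \<subseteq> R\<^sub>2"
  proof -
    have "R (carrier D - G\<^sub>1) (carrier D) \<subseteq> J \<rightarrow>\<^sub>E carrier D"
      unfolding R_def using G\<^sub>1D by (auto intro!: PiE_mono split: if_splits)
    thus ?thesis
      using mem unfolding R\<^sub>2_def by blast
  qed
  moreover have "R\<^sub>0 \<subseteq> J \<rightarrow>\<^sub>E carrier D" "R\<^sub>1 \<subseteq> J \<rightarrow>\<^sub>E carrier D" "R\<^sub>2 \<subseteq> J \<rightarrow>\<^sub>E carrier D"
    using R\<^sub>0\<^sub>1 R\<^sub>1D unfolding R\<^sub>0_def R\<^sub>1_def R\<^sub>2_def by auto
  ultimately have "|R\<^sub>0| =o |Pow J|" "|R\<^sub>1| =o |Pow J|" "|R\<^sub>2| =o |Pow J|"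
    using card[of G\<^sub>0 G\<^sub>1 R\<^sub>0 g\<^sub>0] card[of "G\<^sub>1 - G\<^sub>0" G\<^sub>1 R\<^sub>1 g\<^sub>1] card[of "carrier D - G\<^sub>1" "carrier D" R\<^sub>2 d]
      G\<^sub>1D g\<^sub>0 g\<^sub>1 d R\<^sub>0_def by simp_all
  then obtain b\<^sub>0 b\<^sub>1 b\<^sub>2 where b: "bij_betw b\<^sub>0 P\<^sub>0 R\<^sub>0" "bij_betw b\<^sub>1 P\<^sub>1 R\<^sub>1" "bij_betw b\<^sub>2 P\<^sub>2 R\<^sub>2"
    using bij P(1-3) by metis
  define \<chi> where "\<chi> s = (if s \<in> P\<^sub>0 then b\<^sub>0 s else if s \<in> P\<^sub>1 then b\<^sub>1 s else b\<^sub>2 s)" for s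
  have \<chi>b: "bij_betw \<chi> P\<^sub>0 R\<^sub>0" "bij_betw \<chi> P\<^sub>1 R\<^sub>1" "bij_betw \<chi> P\<^sub>2 R\<^sub>2"
    using P(4-6) by (auto simp: \<chi>_def intro!: bij_betw_cong[THEN iffD1, OF _ b(1)]
      bij_betw_cong[THEN iffD1, OF _ b(2)] bij_betw_cong[THEN iffD1, OF _ b(3)])
  have \<chi>\<^sub>0\<^sub>1: "bij_betw \<chi> (P\<^sub>0 \<union> P\<^sub>1) (R G\<^sub>1 G\<^sub>1)"
    using bij_betw_combine[OF \<chi>b(1,2)] R\<^sub>0\<^sub>1 unfolding R\<^sub>0_def R\<^sub>1_def by (simp add: Un_absorb1)
  let ?S = "P\<^sub>0 \<union> P\<^sub>1 \<union> P\<^sub>2"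
  have \<chi>: "bij_betw \<chi> ?S (J \<rightarrow>\<^sub>E carrier D)"
    using bij_betw_combine[OF \<chi>\<^sub>0\<^sub>1 \<chi>b(3)] R\<^sub>1D unfolding R\<^sub>2_def by (simp add: Un_absorb1)
  have piece: "{s \<in> ?S. \<forall>j\<in>J. \<chi> s j \<in> (if j = j\<^sub>0 then W else V)} = P"
    if "bij_betw \<chi> P (R W V)" "P \<subseteq> ?S" for P W V
  proof -
    have "(\<forall>j\<in>J. \<chi> s j \<in> (if j = j\<^sub>0 then W else V)) \<longleftrightarrow> s \<in> P" if s: "s \<in> ?S" for s
    proof -
      have "\<chi> s \<in> J \<rightarrow>\<^sub>E carrier D"
        using \<chi> s by (auto simp: bij_betw_def)
      hence "(\<forall>j\<in>J. \<chi> s j \<in> (if j = j\<^sub>0 then W else V)) \<longleftrightarrow> \<chi> s \<in> R W V"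
        unfolding R_def PiE_def Pi_def by auto
      also have "\<dots> \<longleftrightarrow> \<chi> s \<in> \<chi> ` P"
        using \<open>bij_betw \<chi> P (R W V)\<close> by (simp add: bij_betw_def)
      also have "\<dots> \<longleftrightarrow> s \<in> P"
        using \<chi> s \<open>P \<subseteq> ?S\<close> by (intro inj_on_image_mem_iff[of \<chi> ?S]) (auto simp: bij_betw_def)
      finally show ?thesis .
    qed
    thus ?thesis
      using \<open>P \<subseteq> ?S\<close> by blast
  qed
  let ?A = "power_algebra D J ?S \<chi>"
  have "suszko_reduced l ?A {s \<in> ?S. \<forall>j\<in>J. \<chi> s j \<in> (if j = j\<^sub>0 then W else G\<^sub>1)}"
    if "suszko_reduced l D W" for W
    by (rule suszko_reduced_power[OF l \<chi> D]) (use that G\<^sub>1 in simp)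
  from this[OF G\<^sub>0] this[OF G\<^sub>1] have "suszko_reduced l ?A P\<^sub>0" "suszko_reduced l ?A (P\<^sub>0 \<union> P\<^sub>1)"
    using piece[OF \<chi>b(1)[unfolded R\<^sub>0_def]] piece[OF \<chi>\<^sub>0\<^sub>1] by (simp_all add: le_supI1)
  thus ?thesis
    by (intro that[of ?A]) auto
qed


section \<open>Translations of terms\<close>

primrec translate :: "('f \<Rightarrow> ('g, nat) tm) \<Rightarrow> ('f, 'v) tm \<Rightarrow> ('g, 'v) tm" where
  "translate \<tau> (Var x) = Var x"
| "translate \<tau> (Fun f ts) = subst (\<lambda>i. map (translate \<tau>) ts ! i) (\<tau> f)"

lemma translate_terms:
  assumes "translation L L' \<tau>" and "t \<in> terms L X"
  shows "translate \<tau> t \<in> terms L' X"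
  using assms(2)
proof induction
  case (Fun f ts)
  hence "\<tau> f \<in> terms L' {..<length ts}"
    using assms(1) by (simp add: translation_def)
  thus ?case
    using Fun.IH by (auto elim!: subst_terms)
qed (auto intro: terms.Var)

lemma eval_translate:
  assumes "translation L L' \<tau>" and "t \<in> terms L X"
  shows "eval A v (translate \<tau> t) = eval (translate_algebra \<tau> A) v t"
  using assms(2)
proof induction
  case (Fun f ts)
  hence \<tau>: "\<tau> f \<in> terms L' {..<length ts}"
    using assms(1) by (simp add: translation_def)
  have "eval A v (translate \<tau> (Fun f ts)) = eval A (\<lambda>i. eval A v (map (translate \<tau>) ts ! i)) (\<tau> f)"
    by (simp add: eval_subst)
  also have "\<dots> = eval A (\<lambda>i. map (eval (translate_algebra \<tau> A) v) ts ! i) (\<tau> f)"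
    using Fun.IH by (intro eval_cong_terms[OF \<tau>]) simp
  finally show ?case
    by (simp add: translate_algebra_def)
qed simp

lemma carrier_translate_algebra [simp]: "carrier (translate_algebra \<tau> A) = carrier A"
  by (simp add: translate_algebra_def)

lemma is_algebra_translate:
  assumes \<tau>: "translation L L' \<tau>" and A: "is_algebra L' A"
  shows "is_algebra L (translate_algebra \<tau> A)"
proof -
  have "eval A (\<lambda>i. as ! i) (\<tau> f) \<in> carrier A"
    if "f \<in> syms L" "length as = arity L f" "set as \<subseteq> carrier A" for f as
  proof (rule eval_closed[OF A])
    show "\<tau> f \<in> terms L' {..<length as}"
      using \<tau> that by (simp add: translation_def)
    show "as ! i \<in> carrier A" if "i \<in> {..<length as}" for i
      using that \<open>set as \<subseteq> carrier A\<close> by (auto simp: subset_iff)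
  qed
  moreover have "carrier A \<noteq> {}"
    using A by (simp add: is_algebra_def)
  ultimately show ?thesis
    by (simp add: is_algebra_def) (simp add: translate_algebra_def)
qed

text \<open>The reduct along the composite translation and the iterated reduct agree on the symbols of the
  language only, so the identity map transports the model from one to the other.\<close>

lemma interpretable_trans:
  assumes l: "is_logic l" and "l \<preceq> l'" and "l' \<preceq> l''"
  shows "l \<preceq> l''"
proof -
  obtain \<sigma> \<tau> where \<sigma>: "interpretation_into \<sigma> l l'" and \<tau>: "interpretation_into \<tau> l' l''"
    using assms(2,3) by (auto simp: interpretable_def)
  have tr: "translation (lang l) (lang l') \<sigma>" "translation (lang l') (lang l'') \<tau>"
    using \<sigma> \<tau> by (auto simp: interpretation_into_def)
  let ?\<rho> = "\<lambda>f. translate \<tau> (\<sigma> f)"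
  have tr': "translation (lang l) (lang l'') ?\<rho>"
    using tr(1) unfolding translation_def by (blast intro: translate_terms[OF tr(2)])
  have "(translate_algebra ?\<rho> A, F) \<in> Mod_Suszko l" if M: "(A, F) \<in> Mod_Suszko l''" for A F
  proof -
    let ?B = "translate_algebra \<sigma> (translate_algebra \<tau> A)"
    have B: "(?B, F) \<in> Mod_Suszko l"
      using M \<sigma> \<tau> unfolding interpretation_into_def by fast
    have A: "is_algebra (lang l'') A"
      using M by (simp add: Mod_Suszko_def)
    note algs = is_algebra_translate[OF tr(1) is_algebra_translate[OF tr(2) A]]
      is_algebra_translate[OF tr' A]
    have eq: "interp (translate_algebra ?\<rho> A) f as = interp ?B f as" if "f \<in> syms (lang l)" for f as
    proof -
      have "\<sigma> f \<in> terms (lang l') {..<arity (lang l) f}"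
        using tr(1) that by (simp add: translation_def)
      hence "eval A (\<lambda>i. as ! i) (translate \<tau> (\<sigma> f)) = eval (translate_algebra \<tau> A) (\<lambda>i. as ! i) (\<sigma> f)"
        by (rule eval_translate[OF tr(2)])
      thus ?thesis
        by (simp add: translate_algebra_def)
    qed
    have "suszko_reduced l (translate_algebra ?\<rho> A) F"
    proof (rule suszko_reducedI[OF l algs(2)])
      have hom: "is_hom (lang l) (translate_algebra ?\<rho> A) ?B id"
        unfolding is_hom_def using eq by simp
      have "deductive_filter l ?B F"
        using B by (simp add: Mod_Suszko_def)
      moreover have "F \<subseteq> carrier A"
        using filter_subset[OF calculation] by simp
      hence "{a \<in> carrier (translate_algebra ?\<rho> A). id a \<in> F} = F"
        by auto
      ultimately show "deductive_filter l (translate_algebra ?\<rho> A) F"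
        using filter_vimage[OF l hom, of F] by simp
      show "\<exists>B G h. suszko_reduced l (B :: ('a, 'a) algebra) G \<and>
          is_hom (lang l) (translate_algebra ?\<rho> A) B h \<and>
          h ` carrier (translate_algebra ?\<rho> A) = carrier B \<and> h ` F \<subseteq> G \<and> h a \<noteq> h b"
        if "a \<noteq> b" for a b
        using hom B that by (intro exI[of _ ?B] exI[of _ F] exI[of _ id]) (simp add: Mod_Suszko_iff)
    qed
    thus ?thesis
      using B by (simp add: Mod_Suszko_iff)
  qed
  thus ?thesis
    using tr' unfolding interpretable_def interpretation_into_def by (intro exI[of _ ?\<rho>]) blast
qed


section \<open>Logics of matrices over one algebra\<close>

definition matrix_logic :: "'u::wellorder language \<Rightarrow> 'u \<Rightarrow> ('u, 'a) algebra \<Rightarrow> 'a set set \<Rightarrow> 'u logic" where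
  "matrix_logic L \<kappa> A \<F> = \<lparr>lang = L, nvars = \<kappa>, entails = \<lambda>\<Gamma> \<phi>.
     \<Gamma> \<subseteq> terms L {..<\<kappa>} \<and> \<phi> \<in> terms L {..<\<kappa>} \<and>
     (\<forall>v F. F \<in> \<F> \<longrightarrow> v ` {..<\<kappa>} \<subseteq> carrier A \<longrightarrow> eval A v ` \<Gamma> \<subseteq> F \<longrightarrow> eval A v \<phi> \<in> F)\<rparr>"

lemma matrix_logic_sel [simp]:
  "lang (matrix_logic L \<kappa> A \<F>) = L"
  "nvars (matrix_logic L \<kappa> A \<F>) = \<kappa>"
  "entails (matrix_logic L \<kappa> A \<F>) \<Gamma> \<phi> \<longleftrightarrow>
     \<Gamma> \<subseteq> terms L {..<\<kappa>} \<and> \<phi> \<in> terms L {..<\<kappa>} \<and>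
     (\<forall>v F. F \<in> \<F> \<longrightarrow> v ` {..<\<kappa>} \<subseteq> carrier A \<longrightarrow> eval A v ` \<Gamma> \<subseteq> F \<longrightarrow> eval A v \<phi> \<in> F)"
  by (simp_all add: matrix_logic_def)

lemma is_logic_matrix_logic:
  assumes L: "is_language L" and \<kappa>: "infinite_cardinal \<kappa>" and A: "is_algebra L A"
  shows "is_logic (matrix_logic L \<kappa> A \<F>)"
proof -
  let ?l = "matrix_logic L \<kappa> A \<F>"
  have ne: "{..<\<kappa>} \<noteq> {}"
    using \<kappa> unfolding infinite_cardinal_def by fastforce
  have "consequence_relation (terms L {..<\<kappa>}) (entails ?l)"
    unfolding consequence_relation_def
  proof (intro conjI allI impI)
    fix \<Gamma> \<Delta> \<phi>
    assume *: "\<Gamma> \<subseteq> terms L {..<\<kappa>} \<and> (\<forall>\<delta>\<in>\<Delta>. entails ?l \<Gamma> \<delta>) \<and> entails ?l \<Delta> \<phi>"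
    have "eval A v \<phi> \<in> F" if "F \<in> \<F>" "v ` {..<\<kappa>} \<subseteq> carrier A" "eval A v ` \<Gamma> \<subseteq> F" for v F
    proof -
      have "eval A v ` \<Delta> \<subseteq> F"
        using * that by auto
      thus ?thesis
        using * that by auto
    qed
    thus "entails ?l \<Gamma> \<phi>"
      using * by simp
  qed auto
  moreover have "entails ?l (\<sigma> ` \<Gamma>) (\<sigma> \<phi>)"
    if \<sigma>: "is_hom L (Fm L \<kappa>) (Fm L \<kappa>) \<sigma>" and e: "entails ?l \<Gamma> \<phi>" for \<sigma> \<Gamma> \<phi>
  proof -
    have \<sigma>in: "\<sigma> \<psi> \<in> terms L {..<\<kappa>}" if "\<psi> \<in> terms L {..<\<kappa>}" for \<psi>
      using \<sigma> that by (auto simp: is_hom_def)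
    have ev: "eval A v (\<sigma> \<psi>) = eval A (\<lambda>x. eval A v (\<sigma> (Var x))) \<psi>" if "\<psi> \<in> terms L {..<\<kappa>}" for v \<psi>
      using hom_Fm_eq_eval[OF \<sigma> that ne] by (simp add: eval_Fm eval_subst)
    have "eval A v (\<sigma> \<phi>) \<in> F"
      if F: "F \<in> \<F>" "v ` {..<\<kappa>} \<subseteq> carrier A" "eval A v ` \<sigma> ` \<Gamma> \<subseteq> F" for v F
    proof -
      let ?w = "\<lambda>x. eval A v (\<sigma> (Var x))"
      have "?w x \<in> carrier A" if "x \<in> {..<\<kappa>}" for x
        using eval_closed[OF A \<sigma>in[OF terms.Var[OF that]]] F(2) by blast
      hence "?w ` {..<\<kappa>} \<subseteq> carrier A"
        by blast
      moreover have "eval A ?w ` \<Gamma> \<subseteq> F"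
      proof
        fix y assume "y \<in> eval A ?w ` \<Gamma>"
        then obtain \<gamma> where "\<gamma> \<in> \<Gamma>" "y = eval A ?w \<gamma>" by blast
        moreover have "\<gamma> \<in> terms L {..<\<kappa>}"
          using e \<open>\<gamma> \<in> \<Gamma>\<close> by auto
        ultimately have "y \<in> eval A v ` \<sigma> ` \<Gamma>"
          using ev by (metis imageI)
        thus "y \<in> F"
          using F(3) by blast
      qed
      ultimately have "eval A ?w \<phi> \<in> F"
        using e F(1) unfolding matrix_logic_sel by blast
      thus ?thesis
        using ev e by simp
    qed
    thus ?thesis
      using e \<sigma>in by auto
  qed
  ultimately show ?thesis
    using L \<kappa> by (simp add: is_logic_def del: matrix_logic_sel(3))
qed

lemma matrix_logic_filter:
  assumes "is_language L" "infinite_cardinal \<kappa>" and A: "is_algebra L A" and F: "F \<in> \<F>" "F \<subseteq> carrier A"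
  shows "deductive_filter (matrix_logic L \<kappa> A \<F>) A F"
proof (rule filterI[OF is_logic_matrix_logic[OF assms(1-3)] F(2)])
  fix \<Gamma> \<phi> v
  assume "entails (matrix_logic L \<kappa> A \<F>) \<Gamma> \<phi>" "v ` {..<nvars (matrix_logic L \<kappa> A \<F>)} \<subseteq> carrier A" "eval A v ` \<Gamma> \<subseteq> F"
  thus "eval A v \<phi> \<in> F"
    using F(1) by simp
qed

text \<open>Models respect the inferences valid in the defining matrices, regardless of the names of
  the variables, as long as there are not too many of them.\<close>

lemma matrix_logic_valid:
  assumes B: "is_algebra L B" and H: "deductive_filter (matrix_logic L \<kappa> A \<F>) B H"
    and X: "|X| \<le>o |{..<\<kappa>}|" and terms: "\<Gamma> \<subseteq> terms L X" "\<phi> \<in> terms L X"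
    and valid: "\<And>v F. F \<in> \<F> \<Longrightarrow> v ` X \<subseteq> carrier A \<Longrightarrow> eval A v ` \<Gamma> \<subseteq> F \<Longrightarrow> eval A v \<phi> \<in> F"
    and w: "w ` X \<subseteq> carrier B" and sub: "eval B w ` \<Gamma> \<subseteq> H"
  shows "eval B w \<phi> \<in> H"
proof -
  obtain \<rho> where \<rho>: "inj_on \<rho> X" "\<rho> ` X \<subseteq> {..<\<kappa>}"
    using X unfolding card_of_ordLeq[symmetric] by blast
  let ?r = "subst (Var \<circ> \<rho>)"
  have r: "?r t \<in> terms L {..<\<kappa>}" if "t \<in> terms L X" for t
    using that \<rho>(2) by (auto elim!: subst_terms intro!: terms.Var)
  have e: "entails (matrix_logic L \<kappa> A \<F>) (?r ` \<Gamma>) (?r \<phi>)"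
    unfolding matrix_logic_sel
  proof (intro conjI allI impI)
    fix v F
    assume F: "F \<in> \<F>" "v ` {..<\<kappa>} \<subseteq> carrier A" "eval A v ` ?r ` \<Gamma> \<subseteq> F"
    have "(v \<circ> \<rho>) ` X \<subseteq> carrier A"
      using F(2) \<rho>(2) by auto
    moreover have "eval A (v \<circ> \<rho>) ` \<Gamma> \<subseteq> F"
      using F(3) by (simp add: eval_rename image_image)
    ultimately show "eval A v (?r \<phi>) \<in> F"
      using valid[OF F(1)] by (simp add: eval_rename)
  qed (use r terms in auto)
  obtain b where b: "b \<in> carrier B"
    using B by (auto simp: is_algebra_def)
  define w' where "w' y = (if y \<in> \<rho> ` X then w (inv_into X \<rho> y) else b)" for y
  have evB: "eval B w' (?r t) = eval B w t" if "t \<in> terms L X" for t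
    unfolding eval_rename using \<rho>(1) by (intro eval_cong_terms[OF that]) (simp add: w'_def)
  have "eval B w' (?r \<phi>) \<in> H"
  proof (rule filter_eval[OF _ H e])
    show "w' ` {..<nvars (matrix_logic L \<kappa> A \<F>)} \<subseteq> carrier B"
      using b w inv_into_into[of _ \<rho> X] by (auto simp: w'_def)
    show "eval B w' ` ?r ` \<Gamma> \<subseteq> H"
    proof
      fix y assume "y \<in> eval B w' ` ?r ` \<Gamma>"
      then obtain \<gamma> where "\<gamma> \<in> \<Gamma>" "y = eval B w' (?r \<gamma>)" by blast
      thus "y \<in> H"
        using evB terms(1) sub by (metis image_subset_iff subsetD)
    qed
  qed (use B in simp)
  thus ?thesis
    using evB[OF terms(2)] by simp
qed


section \<open>The algebra of all finitary operations\<close>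

definition operations :: "'a set \<Rightarrow> (nat \<times> ('a list \<Rightarrow> 'a)) set" where
  "operations S = {(n, g). 0 < n \<and> g \<in> {xs. length xs = n \<and> set xs \<subseteq> S} \<rightarrow>\<^sub>E S}"

text \<open>An operation is determined by the set of all lists that consist of a value followed by the
  arguments at which it is attained.\<close>

lemma card_of_operations:
  assumes "infinite S"
  shows "|operations S| \<le>o |Pow S|"
proof -
  obtain i where i: "inj_on i (lists S)" "i ` lists S \<subseteq> S"
    using card_of_lists[OF assms] unfolding card_of_ordLeq[symmetric] by blast
  define graph where "graph = (\<lambda>(n, g). {g xs # xs |xs. length xs = n \<and> set xs \<subseteq> S})"
  have graph: "graph x \<subseteq> lists S" if "x \<in> operations S" for x
  proof -
    obtain n g where x: "x = (n, g)" by (cases x)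
    have "g xs \<in> S" if "length xs = n" "set xs \<subseteq> S" for xs
      using \<open>x \<in> operations S\<close> that unfolding x operations_def by (auto dest: PiE_mem)
    thus ?thesis
      by (auto simp: x graph_def lists_eq_set)
  qed
  obtain s where s: "s \<in> S"
    using assms by fastforce
  have inj: "x = y" if x: "x \<in> operations S" and y: "y \<in> operations S" and eq: "graph x = graph y" for x y
  proof -
    obtain n g m h where ng: "x = (n, g)" "y = (m, h)"
      by (cases x, cases y)
    have eq': "{g xs # xs |xs. length xs = n \<and> set xs \<subseteq> S} = {h xs # xs |xs. length xs = m \<and> set xs \<subseteq> S}"
      using eq by (simp add: ng graph_def)
    have "g (replicate n s) # replicate n s \<in> {g xs # xs |xs. length xs = n \<and> set xs \<subseteq> S}"
    proof (intro CollectI exI[of _ "replicate n s"] conjI refl)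
      show "set (replicate n s) \<subseteq> S"
        using s by (simp add: set_replicate_conv_if)
    qed simp
    hence nm: "n = m"
      unfolding eq' by auto
    have gh: "g xs = h xs" if "xs \<in> {xs. length xs = n \<and> set xs \<subseteq> S}" for xs
    proof -
      have "g xs # xs \<in> {g xs # xs |xs. length xs = n \<and> set xs \<subseteq> S}"
        using that by blast
      thus ?thesis
        unfolding eq' by simp
    qed
    have "g \<in> {xs. length xs = n \<and> set xs \<subseteq> S} \<rightarrow>\<^sub>E S" "h \<in> {xs. length xs = n \<and> set xs \<subseteq> S} \<rightarrow>\<^sub>E S"
      using x y nm by (simp_all add: operations_def ng)
    hence "g = h"
      by (rule PiE_ext) (rule gh)
    thus ?thesis
      by (simp add: ng nm)
  qed
  have cancel: "graph x = graph y" if "i ` graph x = i ` graph y" "x \<in> operations S" "y \<in> operations S" for x y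
    using that inj_on_image_eq_iff[OF i(1) graph[OF that(2)] graph[OF that(3)]] by simp
  have "inj_on (\<lambda>x. i ` graph x) (operations S)"
    by (rule inj_onI) (rule inj[OF _ _ cancel])
  moreover have "(\<lambda>x. i ` graph x) ` operations S \<subseteq> Pow S"
    using graph i(2) by blast
  ultimately show ?thesis
    unfolding card_of_ordLeq[symmetric] by blast
qed


text \<open>The matrices \<open>(S, F\<^sub>0)\<close> and \<open>(S, F\<^sub>1)\<close> over the algebra of all finitary operations on \<open>S\<close>. Symbols
  of a language are elements of the universe, and \<open>code\<close> turns operations into such.\<close>

locale full_matrices =
  fixes S :: "'u::wellorder set" and F\<^sub>0 F\<^sub>1 and code :: "nat \<times> ('u list \<Rightarrow> 'u) \<Rightarrow> 'u"
    and \<kappa> :: 'u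
  assumes code: "inj_on code (operations S)" "small (code ` operations S)"
    and F: "F\<^sub>0 \<subset> F\<^sub>1" "F\<^sub>1 \<subset> S" "F\<^sub>0 \<noteq> {}"
    and \<kappa>: "infinite_cardinal \<kappa>"
begin

definition full_lang :: "'u language" where
  "full_lang = \<lparr>syms = code ` operations S, arity = \<lambda>f. fst (inv_into (operations S) code f)\<rparr>"

definition full_alg :: "('u, 'u) algebra" where
  "full_alg = \<lparr>carrier = S, interp = \<lambda>f. snd (inv_into (operations S) code f)\<rparr>"

definition symb :: "nat \<Rightarrow> ('u list \<Rightarrow> 'u) \<Rightarrow> 'u" where
  "symb n g = code (n, restrict g {xs. length xs = n \<and> set xs \<subseteq> S})"

abbreviation full_logic :: "'u logic" where
  "full_logic \<equiv> matrix_logic full_lang \<kappa> full_alg {F\<^sub>0, F\<^sub>1}"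

lemma carrier_full_alg [simp]: "carrier full_alg = S"
  by (simp add: full_alg_def)

lemma symb:
  assumes "0 < n" and "\<And>xs. length xs = n \<Longrightarrow> set xs \<subseteq> S \<Longrightarrow> g xs \<in> S"
  shows "symb n g \<in> syms full_lang" "arity full_lang (symb n g) = n"
    and "length xs = n \<Longrightarrow> set xs \<subseteq> S \<Longrightarrow> interp full_alg (symb n g) xs = g xs"
proof -
  have op: "(n, restrict g {xs. length xs = n \<and> set xs \<subseteq> S}) \<in> operations S"
    using assms by (simp add: operations_def)
  thus "symb n g \<in> syms full_lang"
    by (simp add: symb_def full_lang_def)
  have inv: "inv_into (operations S) code (symb n g) = (n, restrict g {xs. length xs = n \<and> set xs \<subseteq> S})"
    unfolding symb_def by (rule inv_into_f_f[OF code(1) op])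
  show "arity full_lang (symb n g) = n"
    by (simp add: full_lang_def inv)
  show "length xs = n \<Longrightarrow> set xs \<subseteq> S \<Longrightarrow> interp full_alg (symb n g) xs = g xs"
    by (simp add: full_alg_def inv)
qed

lemma operation_cases:
  assumes "f \<in> syms full_lang"
  shows "0 < arity full_lang f"
    and "length as = arity full_lang f \<Longrightarrow> set as \<subseteq> S \<Longrightarrow> interp full_alg f as \<in> S"
proof -
  obtain n g where f: "f = code (n, g)" and op: "(n, g) \<in> operations S"
    using assms by (auto simp: full_lang_def)
  have inv: "inv_into (operations S) code f = (n, g)"
    unfolding f by (rule inv_into_f_f[OF code(1) op])
  show "0 < arity full_lang f"
    using op inv by (simp add: full_lang_def) (simp add: operations_def)
  show "length as = arity full_lang f \<Longrightarrow> set as \<subseteq> S \<Longrightarrow> interp full_alg f as \<in> S"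
  proof -
    assume as: "length as = arity full_lang f" "set as \<subseteq> S"
    have "g \<in> {xs. length xs = n \<and> set xs \<subseteq> S} \<rightarrow>\<^sub>E S"
      using op by (simp add: operations_def)
    moreover have "as \<in> {xs. length xs = n \<and> set xs \<subseteq> S}"
      using as inv by (simp add: full_lang_def)
    ultimately have "g as \<in> S"
      by (rule PiE_mem)
    thus "interp full_alg f as \<in> S"
      by (simp add: full_alg_def inv)
  qed
qed

lemma is_language_full: "is_language full_lang"
  using operation_cases(1) code(2) by (simp add: is_language_def) (simp add: full_lang_def)

lemma is_algebra_full: "is_algebra full_lang full_alg"
  using operation_cases(2) F by (auto simp: is_algebra_def)

lemma is_logic_full: "is_logic full_logic"
  by (rule is_logic_matrix_logic[OF is_language_full \<kappa> is_algebra_full])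

text \<open>Truth values inside \<open>S\<close>. A false statement is sent outside the larger filter and a true one into
  the smaller, so that both matrices read them in the same way.\<close>

definition decide :: "bool \<Rightarrow> 'u" where
  "decide P = (if P then SOME a. a \<in> F\<^sub>0 else SOME a. a \<in> S - F\<^sub>1)"

lemma decide: "decide P \<in> S" "F \<in> {F\<^sub>0, F\<^sub>1} \<Longrightarrow> decide P \<in> F \<longleftrightarrow> P"
proof -
  have "(SOME a. a \<in> F\<^sub>0) \<in> F\<^sub>0" "(SOME a. a \<in> S - F\<^sub>1) \<in> S - F\<^sub>1"
    using F(2,3) unfolding some_in_eq by blast+
  thus "decide P \<in> S" "F \<in> {F\<^sub>0, F\<^sub>1} \<Longrightarrow> decide P \<in> F \<longleftrightarrow> P"
    using F by (auto simp: decide_def)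
qed

text \<open>Equality as a connective.\<close>

definition eq_symb :: 'u where
  "eq_symb = symb 2 (\<lambda>xs. decide (xs ! 0 = xs ! 1))"

lemma eq_symb:
  "eq_symb \<in> syms full_lang" "arity full_lang eq_symb = 2"
  "a \<in> S \<Longrightarrow> b \<in> S \<Longrightarrow> interp full_alg eq_symb [a, b] = decide (a = b)"
proof -
  note * = symb[of 2 "\<lambda>xs. decide (xs ! 0 = xs ! 1)", folded eq_symb_def]
  show "eq_symb \<in> syms full_lang" "arity full_lang eq_symb = 2"
    using * decide(1) by simp_all
  show "a \<in> S \<Longrightarrow> b \<in> S \<Longrightarrow> interp full_alg eq_symb [a, b] = decide (a = b)"
    using *(3)[of "[a, b]"] decide(1) by simp
qed

text \<open>Constants are unary, since arities are positive.\<close>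

definition const_symb :: "'u \<Rightarrow> 'u" where
  "const_symb s = symb 1 (\<lambda>_. s)"

lemma const_symb:
  assumes "s \<in> S"
  shows "const_symb s \<in> syms full_lang" "arity full_lang (const_symb s) = 1"
    "a \<in> S \<Longrightarrow> interp full_alg (const_symb s) [a] = s"
proof -
  note * = symb[of 1 "\<lambda>_. s", folded const_symb_def]
  show "const_symb s \<in> syms full_lang" "arity full_lang (const_symb s) = 1"
    using * assms by simp_all
  show "a \<in> S \<Longrightarrow> interp full_alg (const_symb s) [a] = s"
    using *(3)[of "[a]"] assms by simp
qed

lemma reduced_full:
  assumes "F \<in> {F\<^sub>0, F\<^sub>1}"
  shows "suszko_reduced full_logic full_alg F"
proof -
  have filter: "deductive_filter full_logic full_alg F"
    using assms F by (intro matrix_logic_filter is_language_full \<kappa> is_algebra_full) auto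
  have "distinguished full_logic full_alg F a b" if ab: "a \<in> S" "b \<in> S" "a \<noteq> b" for a b
  proof -
    let ?p = "Fun eq_symb [Var None, Var (Some a)]"
    have p: "?p \<in> polys full_lang full_alg"
      unfolding polys_def using ab(1) by (auto simp: eq_symb intro!: terms.intros)
    have "peval full_alg c ?p = decide (c = a)" if "c \<in> S" for c
      using eq_symb(3)[OF that ab(1)] by (simp add: peval_def)
    hence "(peval full_alg a ?p \<in> F) \<noteq> (peval full_alg b ?p \<in> F)"
      using ab decide(2)[OF assms] by simp
    thus ?thesis
      unfolding distinguished_def matrix_logic_sel using filter p by blast
  qed
  thus ?thesis
    using is_algebra_full filter by (simp add: suszko_reduced_def)
qed

text \<open>One algebra carries two distinct filters that make it reduced, so equations cannot tell
  which elements are in the filter.\<close>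

lemma not_truth_equational_full:
  assumes "small S"
  shows "\<not> truth_equational full_logic"
proof
  assume "truth_equational full_logic"
  then obtain E :: "(('u, unit) tm \<times> ('u, unit) tm) set" where
    E: "\<forall>(A, F)\<in>Mod_Suszko full_logic. \<forall>a\<in>carrier A.
      a \<in> F \<longleftrightarrow> (\<forall>(s, t)\<in>E. eval A (\<lambda>_. a) s = eval A (\<lambda>_. a) t)"
    unfolding truth_equational_def by blast
  have "(full_alg, F\<^sub>0) \<in> Mod_Suszko full_logic" "(full_alg, F\<^sub>1) \<in> Mod_Suszko full_logic"
    using reduced_full assms by (simp_all add: Mod_Suszko_iff)
  from bspec[OF E this(1)] bspec[OF E this(2)] have "a \<in> F\<^sub>0 \<longleftrightarrow> a \<in> F\<^sub>1" if "a \<in> S" for a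
    using that by simp
  thus False
    using F by blast
qed

text \<open>The inference from \<open>x = y\<close> and \<open>\<phi>(x)\<close> to \<open>\<phi>(y)\<close> is valid in both matrices, for the connective
  \<open>eq_symb\<close>. So its truth at \<open>a\<close>, \<open>b\<close> in a model makes \<open>a\<close> and \<open>b\<close> indistinguishable.\<close>

lemma eq_symb_collapse:
  assumes H: "suszko_reduced full_logic B H" and ab: "a \<in> carrier B" "b \<in> carrier B"
    and eq: "interp B eq_symb [a, b] \<in> H"
  shows "a = b"
proof (rule ccontr)
  assume "a \<noteq> b"
  hence "distinguished full_logic B H a b"
    using H ab unfolding suszko_reduced_def by blast
  then obtain G p where G: "deductive_filter full_logic B G" "H \<subseteq> G" and p: "p \<in> polys full_lang B"
    and ne: "(peval B a p \<in> G) \<noteq> (peval B b p \<in> G)"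
    unfolding distinguished_def matrix_logic_sel by blast
  have B: "is_algebra full_lang B"
    using H by (simp add: suszko_reduced_def)
  \<comment> \<open>The variables \<open>None\<close> and \<open>Some None\<close> stand for \<open>a\<close> and \<open>b\<close>, the others for parameters.\<close>
  let ?X = "{None, Some None} \<union> Some ` vars p"
  let ?pa = "subst (Var \<circ> map_option Some) p" and ?pb = "subst (Var \<circ> Some) p"
  let ?eq = "Fun eq_symb [Var None, Var (Some None)]"
  let ?w = "case_option a (case_option b id)"
  have pv: "p \<in> terms full_lang (vars p)"
    using p terms_iff_vars[of p full_lang] unfolding polys_def by blast
  have X: "|?X| \<le>o |{..<\<kappa>}|"
    using \<kappa> unfolding infinite_cardinal_def by (intro card_of_finite_le) (simp_all add: finite_vars)
  have "(Var \<circ> map_option Some) x \<in> terms full_lang ?X" if "x \<in> vars p" for x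
    using that by (cases x) (auto intro!: terms.Var)
  hence in_terms: "?pa \<in> terms full_lang ?X" "?pb \<in> terms full_lang ?X" "?eq \<in> terms full_lang ?X"
    by (auto intro!: subst_terms[OF pv] terms.intros simp: eq_symb)
  have w: "?w ` ?X \<subseteq> carrier B"
  proof -
    have "case_option b id x \<in> carrier B" if "x \<in> vars p" for x
      using vars_terms[OF p[unfolded polys_def] that] ab by (cases x) auto
    thus ?thesis
      using ab by auto
  qed
  have evB: "eval B ?w ?pa = peval B a p" "eval B ?w ?pb = peval B b p"
    unfolding eval_rename peval_def by (intro eval_cong; simp split: option.splits)+
  have agree: "eval full_alg v ?pa = eval full_alg v ?pb"
    if "F \<in> {F\<^sub>0, F\<^sub>1}" "v ` ?X \<subseteq> S" "eval full_alg v ?eq \<in> F" for v F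
  proof -
    have "v None = v (Some None)"
      using that eq_symb(3)[of "v None" "v (Some None)"] decide(2) by simp
    hence "v (map_option Some x) = v (Some x)" for x
      by (cases x) simp_all
    thus ?thesis
      unfolding eval_rename by (intro eval_cong) simp
  qed
  have step: "eval B ?w q' \<in> G" if q: "(q, q') \<in> {(?pa, ?pb), (?pb, ?pa)}" "eval B ?w q \<in> G" for q q'
  proof (rule matrix_logic_valid[OF B G(1) X, of "{?eq, q}"])
    show "{?eq, q} \<subseteq> terms full_lang ?X" "q' \<in> terms full_lang ?X"
      using q(1) in_terms by auto
    show "eval B ?w ` {?eq, q} \<subseteq> G"
      using q(2) eq G(2) by auto
    fix v F
    assume F: "F \<in> {F\<^sub>0, F\<^sub>1}" and v: "v ` ?X \<subseteq> carrier full_alg" and vF: "eval full_alg v ` {?eq, q} \<subseteq> F"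
    have "eval full_alg v ?eq \<in> F" "eval full_alg v q \<in> F"
      using vF by blast+
    moreover from this(1) have "eval full_alg v ?pa = eval full_alg v ?pb"
      by (rule agree[OF F v[unfolded carrier_full_alg]])
    ultimately show "eval full_alg v q' \<in> F"
      using q(1) by (elim insertE emptyE Pair_inject) (simp_all only:)
  qed (rule w)
  show False
    using ne step[of ?pa ?pb] step[of ?pb ?pa] unfolding evB by blast
qed

text \<open>The basic operations of an algebra \<open>A\<close> on \<open>S\<close> are among the finitary operations on \<open>S\<close>. This
  yields a translation, and it remains to see that reducts of models are reduced models of \<open>l\<close>.\<close>

context
  fixes l and A :: "('u, 'u) algebra"
  assumes l: "is_logic l" "nvars l \<le> \<kappa>"
    and car: "carrier A = S" and red: "suszko_reduced l A F\<^sub>0" "suszko_reduced l A F\<^sub>1"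
begin

definition full_translation :: "'u \<Rightarrow> ('u, nat) tm" where
  "full_translation f = Fun (symb (arity (lang l) f) (interp A f)) (map Var [0..<arity (lang l) f])"

lemma is_algebra_A: "is_algebra (lang l) A"
  using red(1) by (simp add: suszko_reduced_def)

lemma translation_full: "translation (lang l) full_lang full_translation"
  and interp_full_translation:
    "f \<in> syms (lang l) \<Longrightarrow> length as = arity (lang l) f \<Longrightarrow> set as \<subseteq> S \<Longrightarrow>
      interp (translate_algebra full_translation full_alg) f as = interp A f as"
proof -
  have s: "symb (arity (lang l) f) (interp A f) \<in> syms full_lang"
      "arity full_lang (symb (arity (lang l) f) (interp A f)) = arity (lang l) f"
      "\<And>xs. length xs = arity (lang l) f \<Longrightarrow> set xs \<subseteq> S \<Longrightarrow>
        interp full_alg (symb (arity (lang l) f) (interp A f)) xs = interp A f xs"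
    if f: "f \<in> syms (lang l)" for f
  proof -
    have pos: "0 < arity (lang l) f"
      using l(1) f by (simp add: is_logic_def is_language_def)
    have closed: "interp A f xs \<in> S" if "length xs = arity (lang l) f" "set xs \<subseteq> S" for xs
      using is_algebra_A f that car by (simp add: is_algebra_def)
    show "symb (arity (lang l) f) (interp A f) \<in> syms full_lang"
      "arity full_lang (symb (arity (lang l) f) (interp A f)) = arity (lang l) f"
      "\<And>xs. length xs = arity (lang l) f \<Longrightarrow> set xs \<subseteq> S \<Longrightarrow>
        interp full_alg (symb (arity (lang l) f) (interp A f)) xs = interp A f xs"
      using symb[OF pos, of "interp A f"] closed by simp_all
  qed
  show "translation (lang l) full_lang full_translation"
    unfolding translation_def full_translation_def using s by (auto intro!: terms.intros)
  show "interp (translate_algebra full_translation full_alg) f as = interp A f as"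
    if "f \<in> syms (lang l)" "length as = arity (lang l) f" "set as \<subseteq> S"
  proof -
    have "map (eval full_alg (\<lambda>i. as ! i)) (map Var [0..<arity (lang l) f]) = as"
      using that(2) by (simp add: comp_def map_nth flip: that(2))
    thus ?thesis
      using s(3)[OF that] by (simp add: translate_algebra_def full_translation_def)
  qed
qed

lemma eval_full_translate:
  assumes t: "t \<in> terms (lang l) X" and v: "\<And>x. x \<in> X \<Longrightarrow> v x \<in> S"
  shows "eval full_alg v (translate full_translation t) = eval A v t"
proof -
  have "is_hom (lang l) A (translate_algebra full_translation full_alg) id"
    unfolding is_hom_def using interp_full_translation car by simp
  hence "id (eval A v t) = eval (translate_algebra full_translation full_alg) (\<lambda>x. id (v x)) t"
    by (rule hom_eval[OF _ is_algebra_A t]) (simp add: v car)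
  thus ?thesis
    using eval_translate[OF translation_full t, of full_alg v] by simp
qed

text \<open>The rules of \<open>l\<close> hold in \<open>(A, F\<^sub>0)\<close> and \<open>(A, F\<^sub>1)\<close>, so their translations are inferences of the
  logic of the full matrices.\<close>

lemma filter_full_translate:
  assumes B: "is_algebra full_lang B" and H: "deductive_filter full_logic B H"
  shows "deductive_filter l (translate_algebra full_translation B) H"
proof (rule filterI[OF l(1)])
  let ?B = "translate_algebra full_translation B"
  let ?X = "{..<nvars l}"
  show "H \<subseteq> carrier ?B"
    using filter_subset[OF H] by simp
  fix \<Gamma> \<phi> v
  assume e: "entails l \<Gamma> \<phi>" and v: "v ` ?X \<subseteq> carrier ?B" and sub: "eval ?B v ` \<Gamma> \<subseteq> H"
  note fm = entails_formulas[OF l(1) e]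
  let ?t = "translate full_translation"
  have "eval B v (?t \<phi>) \<in> H"
  proof (rule matrix_logic_valid[OF B H])
    show "|?X| \<le>o |{..<\<kappa>}|"
      using l(2) by (intro card_of_mono1) auto
    show "?t ` \<Gamma> \<subseteq> terms full_lang ?X" "?t \<phi> \<in> terms full_lang ?X"
      using fm translate_terms[OF translation_full] by auto
    show "v ` ?X \<subseteq> carrier B"
      using v by simp
    show "eval B v ` ?t ` \<Gamma> \<subseteq> H"
      using sub fm eval_translate[OF translation_full, of _ ?X B v] by fastforce
    fix u F
    assume F: "F \<in> {F\<^sub>0, F\<^sub>1}" and u: "u ` ?X \<subseteq> carrier full_alg" and uF: "eval full_alg u ` ?t ` \<Gamma> \<subseteq> F"
    have ev: "eval full_alg u (?t \<psi>) = eval A u \<psi>" if "\<psi> \<in> terms (lang l) ?X" for \<psi>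
      using u by (intro eval_full_translate[OF that]) auto
    have "eval A u \<phi> \<in> F"
    proof (rule filter_eval[OF is_algebra_A _ e])
      show "deductive_filter l A F"
        using F red by (auto simp: suszko_reduced_def)
      show "u ` ?X \<subseteq> carrier A"
        using u car by simp
      show "eval A u ` \<Gamma> \<subseteq> F"
        using uF fm ev by fastforce
    qed
    thus "eval full_alg u (?t \<phi>) \<in> F"
      using ev fm by simp
  qed
  thus "eval ?B v \<phi> \<in> H"
    using eval_translate[OF translation_full, of \<phi> ?X B v] fm by simp
qed

text \<open>A filter \<open>G\<close> of \<open>l\<close> on \<open>A\<close> that separates \<open>c\<close> from \<open>d\<close> is carried to all models of the
  logic of the full matrices by the operation that, at the arguments \<open>a\<close>, \<open>b\<close>, \<open>z\<close>, decides
  whether \<open>z \<in> G\<close> in case \<open>(a, b) = (c, d)\<close>, and gives a designated value otherwise.\<close>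

definition member_symb :: "'u \<Rightarrow> 'u \<Rightarrow> 'u set \<Rightarrow> 'u" where
  "member_symb c d G = symb 3 (\<lambda>xs. decide (xs ! 0 = c \<and> xs ! 1 = d \<longrightarrow> xs ! 2 \<in> G))"

lemma member_symb:
  "member_symb c d G \<in> syms full_lang" "arity full_lang (member_symb c d G) = 3"
  "x \<in> S \<Longrightarrow> y \<in> S \<Longrightarrow> z \<in> S \<Longrightarrow>
    interp full_alg (member_symb c d G) [x, y, z] = decide (x = c \<and> y = d \<longrightarrow> z \<in> G)"
proof -
  note * = symb[of 3 "\<lambda>xs. decide (xs ! 0 = c \<and> xs ! 1 = d \<longrightarrow> xs ! 2 \<in> G)", folded member_symb_def]
  show "member_symb c d G \<in> syms full_lang" "arity full_lang (member_symb c d G) = 3"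
    using * decide(1) by simp_all
  show "x \<in> S \<Longrightarrow> y \<in> S \<Longrightarrow> z \<in> S \<Longrightarrow>
      interp full_alg (member_symb c d G) [x, y, z] = decide (x = c \<and> y = d \<longrightarrow> z \<in> G)"
    using *(3)[of "[x, y, z]"] decide(1) by simp
qed

text \<open>For a rule of \<open>l\<close> with premises \<open>\<gamma>\<close> and conclusion \<open>\<phi>\<close>, the inference from the formulas
  \<open>r(x, y, \<gamma>)\<close> to \<open>r(x, y, \<phi>)\<close> is valid, where \<open>r\<close> is the membership symbol: it is trivial unless
  \<open>(x, y) = (c, d)\<close>, in which case it says that \<open>G\<close> is closed under the rule. In the same way
  \<open>F\<^sub>1 \<subseteq> G\<close> makes the inference from \<open>z\<close> to \<open>r(x, y, z)\<close> valid.\<close>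

lemma member_symb_filter:
  fixes c d :: 'u
  assumes G: "deductive_filter l A G" "F\<^sub>1 \<subseteq> G"
    and B: "is_algebra full_lang B" and H: "deductive_filter full_logic B H"
    and ab: "a \<in> carrier B" "b \<in> carrier B"
  defines "G' \<equiv> {z \<in> carrier B. interp B (member_symb c d G) [a, b, z] \<in> H}"
  shows "deductive_filter l (translate_algebra full_translation B) G'" and "H \<subseteq> G'"
proof -
  let ?B = "translate_algebra full_translation B"
  show "H \<subseteq> G'"
  proof
    fix z assume z: "z \<in> H"
    hence zB: "z \<in> carrier B"
      using filter_subset[OF H] by blast
    let ?X = "{0, 1, 2 :: nat}"
    have "eval B (\<lambda>i. if i = 0 then a else if i = 1 then b else z)
        (Fun (member_symb c d G) [Var 0, Var 1, Var (2 :: nat)]) \<in> H"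
    proof (rule matrix_logic_valid[OF B H, where X = ?X and \<Gamma> = "{Var 2}"])
      show "|?X| \<le>o |{..<\<kappa>}|"
        using \<kappa> unfolding infinite_cardinal_def by (intro card_of_finite_le) simp_all
      fix v F
      assume "F \<in> {F\<^sub>0, F\<^sub>1}" "v ` ?X \<subseteq> carrier full_alg" "eval full_alg v ` {Var 2} \<subseteq> F"
      thus "eval full_alg v (Fun (member_symb c d G) [Var 0, Var 1, Var 2]) \<in> F"
        using member_symb(3)[of "v 0" "v 1" "v 2"] decide(2) G(2) F(1) by auto
    qed (use ab z zB in \<open>auto simp: member_symb intro!: terms.intros\<close>)
    thus "z \<in> G'"
      using zB by (simp add: G'_def)
  qed
  show "deductive_filter l ?B G'"
  proof (rule filterI[OF l(1)])
    show "G' \<subseteq> carrier ?B"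
      by (auto simp: G'_def)
    fix \<Gamma> \<phi> v
    assume e: "entails l \<Gamma> \<phi>" and v: "v ` {..<nvars l} \<subseteq> carrier ?B" and sub: "eval ?B v ` \<Gamma> \<subseteq> G'"
    note fm = entails_formulas[OF l(1) e]
    let ?X = "{..<nvars l} <+> (UNIV :: bool set)"
    let ?s = "\<lambda>\<psi>. subst (Var \<circ> Inl) (translate full_translation \<psi>)"
    let ?r = "\<lambda>\<psi>. Fun (member_symb c d G) [Var (Inr True), Var (Inr False), ?s \<psi>]"
    let ?w = "case_sum v (\<lambda>t. if t then a else b)"
    have s: "?s \<psi> \<in> terms full_lang ?X" if "\<psi> \<in> terms (lang l) {..<nvars l}" for \<psi>
      using translate_terms[OF translation_full that] by (rule subst_terms) (auto intro: terms.Var)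
    hence r: "?r \<psi> \<in> terms full_lang ?X" if "\<psi> \<in> terms (lang l) {..<nvars l}" for \<psi>
      using that by (auto simp: member_symb intro!: terms.intros)
    have w: "?w ` ?X \<subseteq> carrier B"
      using v ab by auto
    have evB: "eval B ?w (?r \<psi>) = interp B (member_symb c d G) [a, b, eval ?B v \<psi>]"
      if "\<psi> \<in> terms (lang l) {..<nvars l}" for \<psi>
      using eval_translate[OF translation_full that, of B v]
      by (simp add: eval_rename) (simp add: comp_def)
    have "eval B ?w (?r \<phi>) \<in> H"
    proof (rule matrix_logic_valid[OF B H, where X = ?X and \<Gamma> = "?r ` \<Gamma>"])
      show "|?X| \<le>o |{..<\<kappa>}|"
        using \<kappa> l(2) unfolding infinite_cardinal_def
        by (intro card_of_Plus_ordLeq_infinite_Field card_of_Card_order card_of_mono1 card_of_finite_le)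
          (auto simp: Field_card_of)
      show "?r ` \<Gamma> \<subseteq> terms full_lang ?X" "?r \<phi> \<in> terms full_lang ?X"
        using r fm by auto
      show "eval B ?w ` ?r ` \<Gamma> \<subseteq> H"
      proof
        fix y assume "y \<in> eval B ?w ` ?r ` \<Gamma>"
        then obtain \<gamma> where \<gamma>: "\<gamma> \<in> \<Gamma>" "y = eval B ?w (?r \<gamma>)" by blast
        hence "eval ?B v \<gamma> \<in> G'"
          using sub by blast
        thus "y \<in> H"
          using evB[of \<gamma>] \<gamma> fm by (auto simp: G'_def)
      qed
      fix u F
      assume F: "F \<in> {F\<^sub>0, F\<^sub>1}" and u: "u ` ?X \<subseteq> carrier full_alg" and uF: "eval full_alg u ` ?r ` \<Gamma> \<subseteq> F"
      let ?u = "\<lambda>x. u (Inl x)"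
      have u': "?u x \<in> S" if "x \<in> {..<nvars l}" for x
        using u that by auto
      have in_S: "eval A ?u \<psi> \<in> S" if "\<psi> \<in> terms (lang l) {..<nvars l}" for \<psi>
        using eval_closed[OF is_algebra_A that, of ?u] u' car by simp
      have ev: "eval full_alg u (?r \<psi>) =
          decide (u (Inr True) = c \<and> u (Inr False) = d \<longrightarrow> eval A ?u \<psi> \<in> G)"
        if "\<psi> \<in> terms (lang l) {..<nvars l}" for \<psi>
      proof -
        have "eval full_alg u (?s \<psi>) = eval A ?u \<psi>"
          unfolding eval_rename unfolding comp_def by (rule eval_full_translate[OF that u'])
        moreover have "u (Inr True) \<in> S" "u (Inr False) \<in> S"
          using u by auto
        ultimately show ?thesis
          using member_symb(3) in_S[OF that] by simp
      qed
      have "eval A ?u \<phi> \<in> G" if "u (Inr True) = c" "u (Inr False) = d"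
      proof (rule filter_eval[OF is_algebra_A G(1) e])
        show "?u ` {..<nvars l} \<subseteq> carrier A"
          using u' car by auto
        show "eval A ?u ` \<Gamma> \<subseteq> G"
        proof
          fix y assume "y \<in> eval A ?u ` \<Gamma>"
          then obtain \<gamma> where \<gamma>: "\<gamma> \<in> \<Gamma>" "y = eval A ?u \<gamma>" by blast
          moreover have "eval full_alg u (?r \<gamma>) \<in> F"
            using \<gamma>(1) uF by blast
          moreover have "\<gamma> \<in> terms (lang l) {..<nvars l}"
            using \<gamma>(1) fm by blast
          ultimately show "y \<in> G"
            using ev that decide(2)[OF F] by simp
        qed
      qed
      thus "eval full_alg u (?r \<phi>) \<in> F"
        using ev fm decide(2)[OF F] by simp
    qed (use w in simp)
    moreover have "eval ?B v \<phi> \<in> carrier ?B"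
      using v by (intro eval_closed[OF is_algebra_translate[OF translation_full B] conjunct2[OF fm]]) auto
    ultimately show "eval ?B v \<phi> \<in> G'"
      using evB fm by (simp add: G'_def)
  qed
qed

text \<open>For distinct \<open>c\<close>, \<open>d\<close> in \<open>S\<close> choose a filter \<open>G\<close> of \<open>l\<close> above \<open>F\<^sub>1\<close> and a polynomial \<open>p\<close> that
  separate them, and let \<open>r\<close> be the corresponding membership symbol. Of the formulas
  \<open>r(x, y, p(x))\<close> and \<open>r(x, y, p(y))\<close> one is a theorem: the first if \<open>p(c) \<in> G\<close>, the second if
  \<open>p(d) \<in> G\<close>. If no filter of \<open>l\<close> on the reduct of a model distinguishes \<open>a\<close> from \<open>b\<close>, then at
  \<open>a\<close>, \<open>b\<close> the other formula holds as well. But from both formulas, taken for all pairs of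
  distinct \<open>c\<close> and \<open>d\<close>, it follows that \<open>x = y\<close>, since the instance at \<open>(c, d) = (x, y)\<close> is
  refuted in the matrices. Both formulas are used for every pair, since it depends on \<open>(c, d)\<close> which
  of \<open>p(c)\<close>, \<open>p(d)\<close> is in \<open>G\<close>.\<close>

lemma interpretable_full: "l \<preceq> full_logic"
proof -
  let ?\<tau> = full_translation and ?t = "translate full_translation"
  have "suszko_reduced l (translate_algebra ?\<tau> B) H" if red_B: "suszko_reduced full_logic B H"
    for B :: "('u, 'u) algebra" and H
  proof -
    let ?B = "translate_algebra ?\<tau> B"
    have B: "is_algebra full_lang B" and H: "deductive_filter full_logic B H"
      using red_B by (simp_all add: suszko_reduced_def)
    have alg: "is_algebra (lang l) ?B"
      by (rule is_algebra_translate[OF translation_full B])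
    have "distinguished l ?B H a b" if ab: "a \<in> carrier B" "b \<in> carrier B" "a \<noteq> b" for a b
    proof (rule ccontr)
      assume nd: "\<not> distinguished l ?B H a b"
      let ?Q = "\<lambda>c d G p. deductive_filter l A G \<and> F\<^sub>1 \<subseteq> G \<and> p \<in> polys (lang l) A \<and>
          (peval A c p \<in> G) \<noteq> (peval A d p \<in> G)"
      define G where "G c d = (SOME G. \<exists>p. ?Q c d G p)" for c d
      define p where "p c d = (SOME p. ?Q c d (G c d) p)" for c d
      have Q: "?Q c d (G c d) (p c d)" if "c \<in> S" "d \<in> S" "c \<noteq> d" for c d
      proof -
        have "\<exists>G p. ?Q c d G p"
          using red(2) that car unfolding suszko_reduced_def distinguished_def by blast
        hence "\<exists>p. ?Q c d (G c d) p"
          unfolding G_def by (rule someI_ex)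
        thus ?thesis
          unfolding p_def by (rule someI_ex)
      qed
      have Gp: "deductive_filter l A (G c d)" "F\<^sub>1 \<subseteq> G c d" "p c d \<in> polys (lang l) A"
          "(peval A c (p c d) \<in> G c d) \<noteq> (peval A d (p c d) \<in> G c d)"
        if "c \<in> S" "d \<in> S" "c \<noteq> d" for c d
        using Q[OF that] by blast+
      \<comment> \<open>The variables \<open>True\<close> and \<open>False\<close> stand for \<open>a\<close> and \<open>b\<close>; parameters from \<open>S\<close> are named by
        constants, which are unary symbols here.\<close>
      let ?\<sigma> = "\<lambda>x y. case y of None \<Rightarrow> Var x | Some s \<Rightarrow> Fun (const_symb s) [Var True]"
      let ?P = "\<lambda>c d x. subst (?\<sigma> x) (?t (p c d))"
      let ?r = "\<lambda>c d x. Fun (member_symb c d (G c d)) [Var True, Var False, ?P c d x]"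
      let ?w = "\<lambda>x. if x then a else b"
      let ?q = "\<lambda>c d. subst (\<lambda>y. Var (map_option (\<lambda>s. interp B (const_symb s) [a]) y)) (p c d)"
      have card: "|UNIV :: bool set| \<le>o |{..<\<kappa>}|"
        using \<kappa> unfolding infinite_cardinal_def by (intro card_of_finite_le) simp_all
      have w: "?w ` UNIV \<subseteq> carrier B"
        using ab by auto
      have const_in: "interp B (const_symb s) [a] \<in> carrier B" if "s \<in> S" for s
        using B const_symb[OF that] ab(1) by (simp add: is_algebra_def)
      have p_terms: "?t (p c d) \<in> terms full_lang (insert None (Some ` S))" if "c \<in> S" "d \<in> S" "c \<noteq> d" for c d
        using translate_terms[OF translation_full Gp(3)[OF that, unfolded polys_def]] car by simp
      have \<sigma>_terms: "?\<sigma> x y \<in> terms full_lang UNIV" if "y \<in> insert None (Some ` S)" for x y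
        using that by (auto simp: const_symb intro!: terms.intros)
      have P_terms: "?P c d x \<in> terms full_lang UNIV" if "c \<in> S" "d \<in> S" "c \<noteq> d" for c d x
        using p_terms[OF that] \<sigma>_terms by (rule subst_terms)
      have r_terms: "?r c d x \<in> terms full_lang UNIV" if "c \<in> S" "d \<in> S" "c \<noteq> d" for c d x
        using P_terms[OF that] by (auto simp: member_symb intro!: terms.intros)
      have q: "?q c d \<in> polys (lang l) ?B" if "c \<in> S" "d \<in> S" "c \<noteq> d" for c d
        using Gp(3)[OF that] unfolding polys_def
        by (rule subst_terms) (use const_in car in \<open>auto intro!: terms.Var\<close>)
      have evB: "eval B ?w (?P c d x) = peval ?B (?w x) (?q c d)" if "c \<in> S" "d \<in> S" "c \<noteq> d" for c d x
      proof -
        have "eval B ?w (?P c d x) = eval B (\<lambda>y. eval B ?w (?\<sigma> x y)) (?t (p c d))"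
          by (rule eval_subst)
        also have "\<dots> = eval ?B (\<lambda>y. eval B ?w (?\<sigma> x y)) (p c d)"
          by (rule eval_translate[OF translation_full Gp(3)[OF that, unfolded polys_def]])
        also have "\<dots> = peval ?B (?w x) (?q c d)"
          unfolding peval_def eval_subst by (intro eval_cong) (simp split: option.split)
        finally show ?thesis .
      qed
      have evA: "eval full_alg v (?r c d x) =
          decide (v True = c \<and> v False = d \<longrightarrow> peval A (v x) (p c d) \<in> G c d)"
        if cd: "c \<in> S" "d \<in> S" "c \<noteq> d" and v: "v ` UNIV \<subseteq> S" for c d x v
      proof -
        have vS: "v y \<in> S" for y
          using v by blast
        have "eval full_alg v (?P c d x) = eval full_alg (\<lambda>y. eval full_alg v (?\<sigma> x y)) (?t (p c d))"
          by (rule eval_subst)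
        also have "\<dots> = eval full_alg (case_option (v x) id) (?t (p c d))"
          by (rule eval_cong_terms[OF p_terms[OF cd]]) (use const_symb(3) vS in auto)
        also have "\<dots> = peval A (v x) (p c d)"
          unfolding peval_def
          by (rule eval_full_translate[OF Gp(3)[OF cd, unfolded polys_def]]) (use vS car in auto)
        finally have "eval full_alg v (?P c d x) = peval A (v x) (p c d)" .
        moreover have "peval A (v x) (p c d) \<in> S"
          using peval_closed[OF is_algebra_A Gp(3)[OF cd]] vS car by simp
        ultimately show ?thesis
          using member_symb(3)[OF vS vS] by simp
      qed
      \<comment> \<open>One of the two formulas is a theorem, and by assumption the other then follows in \<open>B\<close>.\<close>
      have r_H: "eval B ?w (?r c d x) \<in> H" if cd: "c \<in> S" "d \<in> S" "c \<noteq> d" for c d x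
      proof -
        define G' where "G' = {z \<in> carrier B. interp B (member_symb c d (G c d)) [a, b, z] \<in> H}"
        have G': "deductive_filter l ?B G'" "H \<subseteq> G'"
          unfolding G'_def by (rule member_symb_filter[OF Gp(1,2)[OF cd] B H ab(1,2)])+
        have iff: "peval ?B a (?q c d) \<in> G' \<longleftrightarrow> peval ?B b (?q c d) \<in> G'"
          using nd G' q[OF cd] unfolding distinguished_def by blast
        have r_iff: "eval B ?w (?r c d y) \<in> H \<longleftrightarrow> peval ?B (?w y) (?q c d) \<in> G'" for y
          using evB[OF cd, of y] peval_closed[OF alg q[OF cd], of "?w y"] ab by (simp add: G'_def)
        obtain y where y: "peval A (if y then c else d) (p c d) \<in> G c d"
          using Gp(4)[OF cd] by (metis (full_types))
        have "eval B ?w (?r c d y) \<in> H"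
        proof (rule matrix_logic_valid[OF B H card, where \<Gamma> = "{}"])
          fix v :: "bool \<Rightarrow> 'u" and F
          assume F: "F \<in> {F\<^sub>0, F\<^sub>1}" and v: "v ` UNIV \<subseteq> carrier full_alg"
          have "peval A (v y) (p c d) \<in> G c d" if "v True = c" "v False = d"
            using y that by (cases y) simp_all
          thus "eval full_alg v (?r c d y) \<in> F"
            using evA[OF cd v[unfolded carrier_full_alg], of y] decide(2)[OF F] by simp
        qed (use r_terms[OF cd] w in simp_all)
        thus ?thesis
          using iff r_iff[of y] r_iff[of x] by (cases x; cases y; simp)
      qed
      let ?\<Gamma> = "{?r c d x |c d x. c \<in> S \<and> d \<in> S \<and> c \<noteq> d}"
      have "eval B ?w (Fun eq_symb [Var True, Var False]) \<in> H"
      proof (rule matrix_logic_valid[OF B H card, where \<Gamma> = ?\<Gamma>])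
        show "?\<Gamma> \<subseteq> terms full_lang UNIV"
          using r_terms by blast
        show "Fun eq_symb [Var True, Var False] \<in> terms full_lang (UNIV :: bool set)"
          by (auto simp: eq_symb intro!: terms.intros)
        show "eval B ?w ` ?\<Gamma> \<subseteq> H"
          using r_H by blast
        fix v :: "bool \<Rightarrow> 'u" and F
        assume F: "F \<in> {F\<^sub>0, F\<^sub>1}" and v: "v ` UNIV \<subseteq> carrier full_alg" and sub: "eval full_alg v ` ?\<Gamma> \<subseteq> F"
        have vS: "v ` UNIV \<subseteq> S"
          using v by simp
        define c d where "c = v True" and "d = v False"
        have cdS: "c \<in> S" "d \<in> S"
          using vS unfolding c_def d_def by blast+
        have "c = d"
        proof (rule ccontr)
          assume ne: "c \<noteq> d"
          have "eval full_alg v (?r c d x) \<in> F" for x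
            using sub cdS ne by blast
          hence "peval A (v x) (p c d) \<in> G c d" for x
            using evA[OF cdS ne vS] decide(2)[OF F] by (simp add: c_def d_def)
          thus False
            using Gp(4)[OF cdS ne] unfolding c_def d_def by blast
        qed
        thus "eval full_alg v (Fun eq_symb [Var True, Var False]) \<in> F"
          using eq_symb(3)[OF cdS] decide(2)[OF F] unfolding c_def d_def by simp
      qed (rule w)
      hence "interp B eq_symb [a, b] \<in> H"
        by simp
      thus False
        using eq_symb_collapse[OF red_B ab(1,2)] ab(3) by blast
    qed
    thus ?thesis
      using alg filter_full_translate[OF B H] by (simp add: suszko_reduced_def)
  qed
  hence "interpretation_into ?\<tau> l full_logic"
    using translation_full by (auto simp: interpretation_into_def Mod_Suszko_iff)
  thus ?thesis
    unfolding interpretable_def by blast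
qed

end

end


section \<open>Meet-primeness\<close>

text \<open>The index set \<open>J\<close> of the powers is chosen at least as large as both algebras, which makes all
  parts of the two powers have the cardinality of \<open>Pow J\<close>. Strong inaccessibility keeps the common
  carrier, and the set of all operations on it, small.\<close>

lemma not_truth_equational_upper_bound:
  fixes l\<^sub>1 l\<^sub>2 :: "'u::wellorder logic"
  assumes U: "inaccessible_universe TYPE('u)"
    and l\<^sub>1: "is_logic l\<^sub>1" "has_theorems l\<^sub>1" "\<not> truth_equational l\<^sub>1"
    and l\<^sub>2: "is_logic l\<^sub>2" "has_theorems l\<^sub>2" "\<not> truth_equational l\<^sub>2"
  obtains l where "is_logic l" "\<not> truth_equational l" "l\<^sub>1 \<preceq> l" "l\<^sub>2 \<preceq> l"
proof -
  have Pow_small: "|Pow X| <o |UNIV :: 'u set|" if "small X" for X :: "'u set"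
    using U that unfolding inaccessible_universe_def by blast
  obtain D\<^sub>1 :: "('u, 'u) algebra" and G\<^sub>1 G\<^sub>1' where D\<^sub>1: "small (carrier D\<^sub>1)"
    "suszko_reduced l\<^sub>1 D\<^sub>1 G\<^sub>1" "suszko_reduced l\<^sub>1 D\<^sub>1 G\<^sub>1'" "G\<^sub>1 \<subset> G\<^sub>1'" "G\<^sub>1 \<noteq> {}" "G\<^sub>1' \<noteq> carrier D\<^sub>1"
    using two_reduced_filters[OF U l\<^sub>1] .
  obtain D\<^sub>2 :: "('u, 'u) algebra" and G\<^sub>2 G\<^sub>2' where D\<^sub>2: "small (carrier D\<^sub>2)"
    "suszko_reduced l\<^sub>2 D\<^sub>2 G\<^sub>2" "suszko_reduced l\<^sub>2 D\<^sub>2 G\<^sub>2'" "G\<^sub>2 \<subset> G\<^sub>2'" "G\<^sub>2 \<noteq> {}" "G\<^sub>2' \<noteq> carrier D\<^sub>2"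
    using two_reduced_filters[OF U l\<^sub>2] .
  define J where "J = carrier D\<^sub>1 \<union> carrier D\<^sub>2 \<union> {..<nvars l\<^sub>1}"
  have J_inf: "infinite J"
    using nvars_infinite[OF l\<^sub>1(1)] by (simp add: J_def)
  have J_small: "small J"
    unfolding J_def by (intro small_Un[OF U] D\<^sub>1(1) D\<^sub>2(1) small_lessThan[OF U])
  have J_card: "|carrier D\<^sub>1| \<le>o |J|" "|carrier D\<^sub>2| \<le>o |J|"
    by (auto simp: J_def intro!: card_of_mono1)
  have K_inf: "infinite (Pow J)"
    using J_inf by (simp add: finite_Pow_iff)
  \<comment> \<open>Three disjoint copies of \<open>Pow J\<close> in the universe, tagged by elements of \<open>Pow J\<close>.\<close>
  have KK: "|Pow J \<times> Pow J| =o |Pow J|"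
    by (rule card_of_Times_same_infinite[OF K_inf])
  have KK_less: "|Pow J \<times> Pow J| <o |UNIV :: 'u set|"
    using KK Pow_small[OF J_small] by (rule ordIso_ordLess_trans)
  then obtain e :: "'u set \<times> 'u set \<Rightarrow> 'u" where e: "inj_on e (Pow J \<times> Pow J)"
    using ordLess_imp_ordLeq[OF KK_less] unfolding card_of_ordLeq[symmetric] by blast
  obtain j where j: "j \<in> J"
    using J_inf by fastforce
  have tags: "{} \<noteq> J" "{} \<noteq> {j}" "J \<noteq> {j}"
    using J_inf j by auto
  define P where "P k = e ` (Pow J \<times> {k})" for k
  have P_card: "|P k| =o |Pow J|" if "k \<subseteq> J" for k
  proof -
    have "bij_betw (\<lambda>X. e (X, k)) (Pow J) (P k)"
      unfolding bij_betw_def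
    proof
      show "inj_on (\<lambda>X. e (X, k)) (Pow J)"
        using e that by (auto simp: inj_on_def)
      show "(\<lambda>X. e (X, k)) ` Pow J = P k"
        by (auto simp: P_def)
    qed
    thus ?thesis
      using card_of_ordIsoI ordIso_symmetric by blast
  qed
  have P_disj: "P k \<inter> P k' = {}" if "k \<subseteq> J" "k' \<subseteq> J" "k \<noteq> k'" for k k'
    using e that by (auto simp: P_def inj_on_def)
  have pieces: "|P {}| =o |Pow J|" "|P J| =o |Pow J|" "|P {j}| =o |Pow J|"
    "P {} \<inter> P J = {}" "P {} \<inter> P {j} = {}" "P J \<inter> P {j} = {}"
    using P_card[of "{}"] P_card[of J] P_card[of "{j}"]
      P_disj[of "{}" J] P_disj[of "{}" "{j}"] P_disj[of J "{j}"] tags j by simp_all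
  define S where "S = P {} \<union> P J \<union> P {j}"
  have S_small: "small S"
  proof -
    have "S \<subseteq> e ` (Pow J \<times> Pow J)"
      using j by (auto simp: S_def P_def)
    thus ?thesis
      unfolding small_def
      using KK_less card_of_mono1 card_of_image ordLeq_ordLess_trans by metis
  qed
  have P_inf: "infinite (P k)" if "k \<subseteq> J" for k
    using card_of_ordIso_finite[OF P_card[OF that]] K_inf by blast
  have S_inf: "infinite S"
    using P_inf[of J] by (simp add: S_def)
  obtain A\<^sub>1 :: "('u, 'u) algebra" where A\<^sub>1: "carrier A\<^sub>1 = S"
    "suszko_reduced l\<^sub>1 A\<^sub>1 (P {})" "suszko_reduced l\<^sub>1 A\<^sub>1 (P {} \<union> P J)"
    unfolding S_def
    by (rule suszko_reduced_on_pieces[OF l\<^sub>1(1) D\<^sub>1(2-6) J_inf J_card(1) pieces])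
  obtain A\<^sub>2 :: "('u, 'u) algebra" where A\<^sub>2: "carrier A\<^sub>2 = S"
    "suszko_reduced l\<^sub>2 A\<^sub>2 (P {})" "suszko_reduced l\<^sub>2 A\<^sub>2 (P {} \<union> P J)"
    unfolding S_def
    by (rule suszko_reduced_on_pieces[OF l\<^sub>2(1) D\<^sub>2(2-6) J_inf J_card(2) pieces])
  have ops: "|operations S| <o |UNIV :: 'u set|"
    using card_of_operations[OF S_inf] Pow_small[OF S_small] by (rule ordLeq_ordLess_trans)
  then obtain code :: "nat \<times> ('u list \<Rightarrow> 'u) \<Rightarrow> 'u" where code: "inj_on code (operations S)"
    using ordLess_imp_ordLeq[OF ops] unfolding card_of_ordLeq[symmetric] by blast
  \<comment> \<open>Enough variables to write down the rules of both logics.\<close>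
  define \<kappa> where "\<kappa> = max (nvars l\<^sub>1) (nvars l\<^sub>2)"
  interpret full_matrices S "P {}" "P {} \<union> P J" code \<kappa>
  proof
    show "small (code ` operations S)"
      unfolding small_def using card_of_image ops by (rule ordLeq_ordLess_trans)
    have "P k \<noteq> {}" if "k \<subseteq> J" for k
      using P_inf[OF that] by force
    thus "P {} \<subset> P {} \<union> P J" "P {} \<union> P J \<subset> S" "P {} \<noteq> {}"
      using pieces(4-6) j unfolding S_def by blast+
    show "infinite_cardinal \<kappa>"
      using l\<^sub>1(1) l\<^sub>2(1) by (auto simp: \<kappa>_def max_def is_logic_def)
  qed (rule code)
  show ?thesis
  proof (rule that)
    show "is_logic full_logic"
      by (rule is_logic_full)
    show "\<not> truth_equational full_logic"
      by (rule not_truth_equational_full[OF S_small])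
    show "l\<^sub>1 \<preceq> full_logic"
      by (rule interpretable_full[OF l\<^sub>1(1) _ A\<^sub>1]) (simp add: \<kappa>_def)
    show "l\<^sub>2 \<preceq> full_logic"
      by (rule interpretable_full[OF l\<^sub>2(1) _ A\<^sub>2]) (simp add: \<kappa>_def)
  qed
qed

lemma leibniz_class_upward:
  assumes "leibniz_class K" and "l \<in> K" and "l \<preceq> l'" and "is_logic l'"
  shows "l' \<in> K"
proof -
  obtain \<Phi> where \<Phi>: "leibniz_condition \<Phi>" "K = Log \<Phi>"
    using assms(1) by (auto simp: leibniz_class_def)
  then obtain \<alpha> where "\<Phi> \<alpha> \<preceq> l"
    using assms(2) by (auto simp: Log_def)
  hence "\<Phi> \<alpha> \<preceq> l'"
    using \<Phi>(1) assms(3) interpretable_trans[of "\<Phi> \<alpha>" l l'] by (simp add: leibniz_condition_def)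
  thus ?thesis
    using assms(4) by (auto simp: \<Phi>(2) Log_def)
qed

theorem theorem5p10:
  fixes K\<^sub>1 K\<^sub>2 :: "'u::wellorder logic set"
  assumes "inaccessible_universe TYPE('u)"
    and "leibniz_class K\<^sub>1" and "leibniz_class K\<^sub>2"
    and "\<forall>l\<in>K\<^sub>1. has_theorems l" and "\<forall>l\<in>K\<^sub>2. has_theorems l"
    and "\<forall>l\<in>K\<^sub>1 \<inter> K\<^sub>2. truth_equational l"
  shows "(\<forall>l\<in>K\<^sub>1. truth_equational l) \<or> (\<forall>l\<in>K\<^sub>2. truth_equational l)"
proof (rule ccontr)
  assume "\<not> ?thesis"
  then obtain l\<^sub>1 l\<^sub>2 where l: "l\<^sub>1 \<in> K\<^sub>1" "\<not> truth_equational l\<^sub>1" "l\<^sub>2 \<in> K\<^sub>2" "\<not> truth_equational l\<^sub>2"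
    by blast
  have "is_logic l\<^sub>1" "is_logic l\<^sub>2"
    using l(1,3) assms(2,3) by (auto simp: leibniz_class_def Log_def)
  then obtain l' where "is_logic l'" "\<not> truth_equational l'" "l\<^sub>1 \<preceq> l'" "l\<^sub>2 \<preceq> l'"
    using not_truth_equational_upper_bound[OF assms(1)] l assms(4,5) by blast
  moreover from this have "l' \<in> K\<^sub>1" "l' \<in> K\<^sub>2"
    using leibniz_class_upward[OF assms(2) l(1)] leibniz_class_upward[OF assms(3) l(3)] by blast+
  ultimately show False
    using assms(6) by blast
qed

end
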